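(* Let $e\ge0$, $n\ge1$, $(n,e)\ne(1,0)$, $d,m\ge2$, let $P(X,S)=S^d+f_{d-1}(X)S^{d-1}+\cdots+f_0(X)$, $Q(X,Y)=Y^m+g_{m-1}(X)Y^{m-1}+\cdots+g_0(X)$ with $f_i,g_j\in k[X]$, and let $R=R_{n,e,P,Q}=k[X,Y,Z]/\langle X^nY-P(X,Q(X,Y)-X^eZ)\rangle$. Let $x,y,z$ be the classes of $X,Y,Z$ in $R$, put $s=Q(x,y)-x^ez$, and let $\partial$ be the locally nilpotent $k$-derivation of $R$ given by $\partial(x)=0$, $\partial(y)=x^e\frac{\partial P}{\partial s}(x,s)$, $\partial(z)=\frac{\partial Q}{\partial y}(x,y)\frac{\partial P}{\partial s}(x,s)-x^n$. Then: (1) $\mathrm{ML}(R)=k[x]$. Consequently, $R$ is semi-rigid, and its unique $\mathrm{LND}$-filtration is the $\partial$-filtration. (2) Every $D\in\mathrm{LND}(R)$ has the form $D=f(x)\partial$ for some $f(x)\in k[x]$. Consequently, $R$ is almost rigid.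
   Context: $k$ is a field of characteristic zero. $\mathrm{LND}(B)$ is the set of locally nilpotent $k$-derivations of a $k$-domain $B$; $\mathrm{ML}(B)=\bigcap_{D\in\mathrm{LND}(B)}\ker D$. The $\partial$-filtration is $\{\ker\partial^{i+1}\}_{i\in\mathbb N}$. $B$ is semi-rigid if all non-zero $\partial\in\mathrm{LND}(B)$ induce the same $\partial$-filtration, which is then called its unique $\mathrm{LND}$-filtration. $B$ is almost rigid if $\mathrm{LND}(B)=\ker(\partial)\cdot\partial$ for some non-zero $\partial\in\mathrm{LND}(B)$. *)

theory Defs
  imports
    "HOL-Algebra.Algebraic_Closure_Type"
    "HOL-Algebra.QuotRing"
    "HOL-Computational_Algebra.Polynomial"
begin

section \<open>Locally nilpotent derivations\<close>

text \<open>
  A \<open>k\<close>-domain is given by a HOL-Algebra ring \<open>B\<close> and the image \<open>K\<close> of the ground field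
  in \<open>B\<close>; the definitions make sense without requiring \<open>B\<close> to be a domain.  Maps on \<open>B\<close> are extensional, so that equality
  of HOL functions is equality of maps on \<open>carrier B\<close>.
\<close>

definition derivations :: "('a, 'b) ring_scheme \<Rightarrow> 'a set \<Rightarrow> ('a \<Rightarrow> 'a) set" where
  "derivations B K =
     {D \<in> carrier B \<rightarrow>\<^sub>E carrier B.
        (\<forall>a\<in>carrier B. \<forall>b\<in>carrier B. D (a \<oplus>\<^bsub>B\<^esub> b) = D a \<oplus>\<^bsub>B\<^esub> D b) \<and>
        (\<forall>c\<in>K. \<forall>a\<in>carrier B. D (c \<otimes>\<^bsub>B\<^esub> a) = c \<otimes>\<^bsub>B\<^esub> D a) \<and>
        (\<forall>a\<in>carrier B. \<forall>b\<in>carrier B.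
           D (a \<otimes>\<^bsub>B\<^esub> b) = (a \<otimes>\<^bsub>B\<^esub> D b) \<oplus>\<^bsub>B\<^esub> (D a \<otimes>\<^bsub>B\<^esub> b))}"

definition LND :: "('a, 'b) ring_scheme \<Rightarrow> 'a set \<Rightarrow> ('a \<Rightarrow> 'a) set" where
  "LND B K = {D \<in> derivations B K. \<forall>b\<in>carrier B. \<exists>i. (D ^^ i) b = \<zero>\<^bsub>B\<^esub>}"

definition ker :: "('a, 'b) ring_scheme \<Rightarrow> ('a \<Rightarrow> 'a) \<Rightarrow> 'a set" where
  "ker B D = {b \<in> carrier B. D b = \<zero>\<^bsub>B\<^esub>}"

definition zero_der :: "('a, 'b) ring_scheme \<Rightarrow> 'a \<Rightarrow> 'a" where
  "zero_der B = (\<lambda>b\<in>carrier B. \<zero>\<^bsub>B\<^esub>)"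

definition scale_der :: "('a, 'b) ring_scheme \<Rightarrow> 'a \<Rightarrow> ('a \<Rightarrow> 'a) \<Rightarrow> 'a \<Rightarrow> 'a" where
  "scale_der B a D = (\<lambda>b\<in>carrier B. a \<otimes>\<^bsub>B\<^esub> D b)"

definition makar_limanov :: "('a, 'b) ring_scheme \<Rightarrow> 'a set \<Rightarrow> 'a set" where
  "makar_limanov B K = (\<Inter>D\<in>LND B K. ker B D)"

definition der_filtration :: "('a, 'b) ring_scheme \<Rightarrow> ('a \<Rightarrow> 'a) \<Rightarrow> nat \<Rightarrow> 'a set" where
  "der_filtration B D = (\<lambda>i. ker B (D ^^ (i + 1)))"

definition semi_rigid :: "('a, 'b) ring_scheme \<Rightarrow> 'a set \<Rightarrow> bool" where
  "semi_rigid B K \<longleftrightarrow>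
     (\<forall>D\<in>LND B K - {zero_der B}. \<forall>E\<in>LND B K - {zero_der B}.
        der_filtration B D = der_filtration B E)"

text \<open>
  Requiring the set of filtrations to be a singleton also guarantees that there is a non-zero
  locally nilpotent derivation, without which \<^const>\<open>semi_rigid\<close> holds vacuously.
\<close>

definition is_unique_LND_filtration ::
    "('a, 'b) ring_scheme \<Rightarrow> 'a set \<Rightarrow> (nat \<Rightarrow> 'a set) \<Rightarrow> bool" where
  "is_unique_LND_filtration B K \<F> \<longleftrightarrow>
     der_filtration B ` (LND B K - {zero_der B}) = {\<F>}"

definition almost_rigid :: "('a, 'b) ring_scheme \<Rightarrow> 'a set \<Rightarrow> bool" where
  "almost_rigid B K \<longleftrightarrow>
     (\<exists>D\<in>LND B K - {zero_der B}. LND B K = (\<lambda>a. scale_der B a D) ` ker B D)"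


section \<open>The rings $R_{n,e,P,Q}$\<close>

text \<open>
  The polynomial ring \<open>k[X,Y,Z]\<close> is \<open>k[X][Y][Z]\<close>, with \<open>Z\<close> the outermost variable.
  Likewise \<open>P \<in> k[X][S]\<close> and \<open>Q \<in> k[X][Y]\<close> have \<open>S\<close>, respectively \<open>Y\<close>, as
  outer variable, so that \<^const>\<open>pderiv\<close> is \<open>\<partial>/\<partial>S\<close>, respectively \<open>\<partial>/\<partial>Y\<close>.
\<close>

type_synonym 'k poly3 = "'k poly poly poly"

definition inX :: "'k::field_char_0 poly \<Rightarrow> 'k poly3" where
  "inX f = [:[:f:]:]"

definition varX :: "'k::field_char_0 poly3" where "varX = [:[:[:0, 1:]:]:]"
definition varY :: "'k::field_char_0 poly3" where "varY = [:[:0, 1:]:]"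
definition varZ :: "'k::field_char_0 poly3" where "varZ = [:0, 1:]"

text \<open>\<open>subst2 A T\<close> is \<open>A(X, T)\<close>.\<close>

definition subst2 :: "'k::field_char_0 poly poly \<Rightarrow> 'k poly3 \<Rightarrow> 'k poly3" where
  "subst2 A T = poly (map_poly inX A) T"

definition polS :: "nat \<Rightarrow> 'k::field_char_0 poly poly \<Rightarrow> 'k poly3" where
  "polS e Q = subst2 Q varY - varX ^ e * varZ"

definition rel_poly ::
    "nat \<Rightarrow> nat \<Rightarrow> 'k::field_char_0 poly poly \<Rightarrow> 'k poly poly \<Rightarrow> 'k poly3" where
  "rel_poly n e P Q = varX ^ n * varY - subst2 P (polS e Q)"

abbreviation kXYZ :: "'k::field_char_0 poly3 ring" where
  "kXYZ \<equiv> ring_of_type_algebra"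

definition R_ideal ::
    "nat \<Rightarrow> nat \<Rightarrow> 'k::field_char_0 poly poly \<Rightarrow> 'k poly poly \<Rightarrow> 'k poly3 set" where
  "R_ideal n e P Q = Idl\<^bsub>kXYZ\<^esub> {rel_poly n e P Q}"

definition R_ring ::
    "nat \<Rightarrow> nat \<Rightarrow> 'k::field_char_0 poly poly \<Rightarrow> 'k poly poly \<Rightarrow> 'k poly3 set ring" where
  "R_ring n e P Q = kXYZ Quot (R_ideal n e P Q)"

definition R_class ::
    "nat \<Rightarrow> nat \<Rightarrow> 'k::field_char_0 poly poly \<Rightarrow> 'k poly poly \<Rightarrow> 'k poly3 \<Rightarrow> 'k poly3 set" where
  "R_class n e P Q A = R_ideal n e P Q +>\<^bsub>kXYZ\<^esub> A"

definition R_base ::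
    "nat \<Rightarrow> nat \<Rightarrow> 'k::field_char_0 poly poly \<Rightarrow> 'k poly poly \<Rightarrow> 'k poly3 set set" where
  "R_base n e P Q = range (\<lambda>c. R_class n e P Q (inX [:c:]))"

text \<open>\<open>R_at_x n e P Q f\<close> is \<open>f(x)\<close> for \<open>f \<in> k[X]\<close>, and \<open>R_kx\<close> is \<open>k[x]\<close>.\<close>

definition R_at_x ::
    "nat \<Rightarrow> nat \<Rightarrow> 'k::field_char_0 poly poly \<Rightarrow> 'k poly poly \<Rightarrow> 'k poly \<Rightarrow> 'k poly3 set" where
  "R_at_x n e P Q f = R_class n e P Q (inX f)"

definition R_kx ::
    "nat \<Rightarrow> nat \<Rightarrow> 'k::field_char_0 poly poly \<Rightarrow> 'k poly poly \<Rightarrow> 'k poly3 set set" where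
  "R_kx n e P Q = range (R_at_x n e P Q)"

text \<open>
  The prescribed values at \<open>x\<close>, \<open>y\<close>, \<open>z\<close> are written as classes of polynomials: the
  quotient map is a homomorphism, so \<open>\<partial>P/\<partial>s (x, s)\<close> is the class of
  \<open>P\<^sub>S(X, Q(X,Y) - X\<^sup>e Z)\<close>, and similarly for the other terms.
\<close>

definition is_R_der ::
    "nat \<Rightarrow> nat \<Rightarrow> 'k::field_char_0 poly poly \<Rightarrow> 'k poly poly \<Rightarrow>
      ('k poly3 set \<Rightarrow> 'k poly3 set) \<Rightarrow> bool" where
  "is_R_der n e P Q \<delta> \<longleftrightarrow>
     \<delta> \<in> LND (R_ring n e P Q) (R_base n e P Q) \<and>
     \<delta> (R_class n e P Q varX) = \<zero>\<^bsub>R_ring n e P Q\<^esub> \<and>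
     \<delta> (R_class n e P Q varY) =
       R_class n e P Q (varX ^ e * subst2 (pderiv P) (polS e Q)) \<and>
     \<delta> (R_class n e P Q varZ) =
       R_class n e P Q
         (subst2 (pderiv Q) varY * subst2 (pderiv P) (polS e Q) - varX ^ n)"

end

theory Submission
  imports Defs "HOL-Computational_Algebra.Formal_Laurent_Series"
begin

text \<open>
  Solving the equations \<open>x\<^sup>n y = P(x,s)\<close> and \<open>x\<^sup>e z = Q(x,y) - s\<close> for \<open>y\<close> and \<open>z\<close> embeds
  \<open>R\<close> into the polynomials in \<open>s\<close> over the Laurent series in \<open>x\<close>, where
  \<open>\<partial>\<close> becomes \<open>x\<^sup>n\<^sup>+\<^sup>e \<cdot> d/ds\<close>. The proof is the degree argument of Makar-Limanov in these coordinates.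

  Order the terms \<open>x\<^sup>J s\<^sup>N\<close> by the exponent of \<open>s\<close>, larger first, and then by the exponent of \<open>x\<close>,
  smaller first. Since \<open>s\<close>, \<open>y\<close>, \<open>z\<close> have \<open>s\<close>-degrees \<open>1\<close>, \<open>d\<close>, \<open>dm\<close>, the monomials
  \<open>s\<^sup>i y\<^sup>j z\<^sup>k\<close> with \<open>i < d\<close> and \<open>j < m\<close> have pairwise distinct \<open>s\<close>-degrees, and every natural
  number occurs. They generate \<open>k[X,Y,Z]\<close> over \<open>k[X]\<close> modulo the relation
  (\<open>reducible\<close>), so the map is indeed injective on \<open>R\<close> (\<open>psi_eq_0_iff\<close>), and the leading exponents
  \<open>(N,J)\<close> of elements of \<open>R\<close> satisfy
  \<open>J \<ge> - n \<lfloor>N/d\<rfloor> - e \<lfloor>N/(dm)\<rfloor>\<close>; those with \<open>N = 0\<close> come from \<open>k[x]\<close> (\<open>range_psi_lead\<close>).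

  A non-zero derivation \<open>D\<close> of \<open>R\<close> is \<open>D(x) \<cdot> \<partial>/\<partial>x + D(s) \<cdot> \<partial>/\<partial>s\<close>. Taking leading parts, there are a shift
  \<open>(b,a)\<close> and scalars \<open>\<alpha>\<close>, \<open>\<beta>\<close>, not both zero, such that \<open>D\<close> sends a leading term \<open>u x\<^sup>J s\<^sup>N\<close> to
  \<open>(\<alpha>J + \<beta>N) u x\<^sup>J\<^sup>+\<^sup>a s\<^sup>N\<^sup>+\<^sup>b\<close> (\<open>lead_lnd\<close>). If \<open>D\<close> is locally nilpotent, then iterating \<open>D\<close> has to annihilate
  every leading exponent of \<open>R\<close> after finitely many steps, all of which stay among the leading exponents
  of \<open>R\<close> (\<open>lnd_chain\<close>). Following \<open>x\<close>, \<open>s\<close>, \<open>y\<close> and \<open>z\<close> in this way leaves an integer problem, whose only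
  solution has \<open>\<alpha> = 0\<close> and \<open>b = -1\<close> (\<open>weight_of_x_zero\<close>); this is where \<open>(n,e) \<noteq> (1,0)\<close> enters.
  But then \<open>D(x)\<close> has negative \<open>s\<close>-degree, so \<open>D(x) = 0\<close>, and \<open>D(s)\<close> has \<open>s\<close>-degree \<open>0\<close>, so
  \<open>D(s) \<in> k[x]\<close> (\<open>lnd_kills_x\<close>).

  Finally, \<open>D(z) \<in> R\<close> has \<open>s\<close>-degree \<open>dm - 1\<close>, just below a jump of the bound on leading exponents, and
  this forces \<open>x\<^sup>n\<^sup>+\<^sup>e\<close> to divide \<open>D(s)\<close>. So \<open>D\<close> is a \<open>k[x]\<close>-multiple of \<open>\<partial>\<close>
  (\<open>lnd_multiple_of_del\<close>), and all assertions can be read off from the resulting description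
  \<open>LND(R) = k[x] \<cdot> \<partial>\<close> (\<open>LND_R\<close>) and from \<open>ker \<partial> = k[x]\<close>.
\<close>

unbundle fps_syntax

section \<open>Leading terms in $k((x))[s]$\<close>

text \<open>
  Integer indices let a derivation that lowers the \<open>s\<close>-degree act on terms of degree \<open>0\<close> as well:
  their images are bounded by the degree \<open>-1\<close>, that is, they vanish.
\<close>

definition s_coeff :: "'k::field_char_0 fls poly \<Rightarrow> int \<Rightarrow> 'k fls" where
  "s_coeff F N = (if N < 0 then 0 else coeff F (nat N))"

text \<open>
  The value \<open>u = 0\<close> is allowed. Then \<open>(N, J)\<close> is only a strict upper bound for the exponents that occur, which
  makes the predicate additive and multiplicative without case distinctions on cancellation.
\<close>

definition lead :: "'k::field_char_0 fls poly \<Rightarrow> int \<Rightarrow> int \<Rightarrow> 'k \<Rightarrow> bool" where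
  "lead F N J u \<longleftrightarrow>
     (\<forall>N'>N. s_coeff F N' = 0) \<and> (\<forall>J'<J. s_coeff F N $$ J' = 0) \<and> s_coeff F N $$ J = u"

lemma leadD:
  assumes "lead F N J u"
  shows "N' > N \<Longrightarrow> s_coeff F N' = 0" "J' < J \<Longrightarrow> s_coeff F N $$ J' = 0" "s_coeff F N $$ J = u"
  using assms by (auto simp: lead_def)

lemma s_coeff_add: "s_coeff (F + G) N = s_coeff F N + s_coeff G N"
  by (simp add: s_coeff_def)

lemma s_coeff_0 [simp]: "s_coeff 0 N = 0"
  by (simp add: s_coeff_def)

lemma lead_0: "lead 0 N J 0"
  by (simp add: lead_def)

lemma lead_add: "lead F N J u \<Longrightarrow> lead G N J v \<Longrightarrow> lead (F + G) N J (u + v)"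
  by (simp add: lead_def s_coeff_add)

lemma lead_weaken:
  assumes "lead F N J u" "N < N' \<or> N = N' \<and> J' < J"
  shows "lead F N' J' 0"
  using assms by (auto simp: lead_def)

lemma lead_unique:
  assumes "lead F N J u" "u \<noteq> 0" "lead F N' J' v" "v \<noteq> 0"
  shows "N = N'" "J = J'"
proof -
  have *: "\<not> (N < N' \<or> N = N' \<and> J' < J)" 
    using lead_weaken[OF assms(1)] leadD(3)[OF assms(3)] assms(4) leadD(3) by metis
  have **: "\<not> (N' < N \<or> N' = N \<and> J < J')" 
    using lead_weaken[OF assms(3)] leadD(3)[OF assms(1)] assms(2) leadD(3) by metis
  from * ** show "N = N'" "J = J'" by auto
qed

lemma lead_nonzero: "lead F N J u \<Longrightarrow> u \<noteq> 0 \<Longrightarrow> F \<noteq> 0"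
  by (auto simp: lead_def)

lemma s_coeff_mult:
  assumes "\<And>N'. N' > N \<Longrightarrow> s_coeff F N' = 0" "\<And>N'. N' > M \<Longrightarrow> s_coeff G N' = 0"
  shows "s_coeff (F * G) (N + M) = s_coeff F N * s_coeff G M" "K > N + M \<Longrightarrow> s_coeff (F * G) K = 0"
proof -
  have zero: "F = 0" if "\<And>N'. N' > N \<Longrightarrow> s_coeff F N' = 0" "N < 0" for N and F :: "'a fls poly"
  proof (rule poly_eqI)
    fix i show "coeff F i = coeff 0 i"
      using that(1)[of "int i"] that(2) by (simp add: s_coeff_def)
  qed
  have "s_coeff (F * G) (N + M) = s_coeff F N * s_coeff G M \<and> (K > N + M \<longrightarrow> s_coeff (F * G) K = 0)"
  proof (cases "N < 0 \<or> M < 0")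
    case True
    then show ?thesis using zero[OF assms(1)] zero[OF assms(2)] by auto
  next
    case False
    then obtain n m where nm: "N = int n" "M = int m"
      by (metis nonneg_int_cases not_less)
    have F: "coeff F i = 0" if "i > n" for i using assms(1)[of "int i"] that nm by (simp add: s_coeff_def)
    have G: "coeff G i = 0" if "i > m" for i using assms(2)[of "int i"] that nm by (simp add: s_coeff_def)
    have dF: "degree F \<le> n" and dG: "degree G \<le> m" using F G by (auto intro: degree_le)
    have "coeff (F * G) (n + m) = coeff F n * coeff G m"
    proof -
      have "coeff (F * G) (n + m) = (\<Sum>i\<le>n + m. coeff F i * coeff G (n + m - i))"
        by (simp add: coeff_mult)
      also have "\<dots> = (\<Sum>i\<le>n + m. if i = n then coeff F n * coeff G m else 0)"
      proof (rule sum.cong)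
        fix i assume "i \<in> {..n + m}"
        show "coeff F i * coeff G (n + m - i) = (if i = n then coeff F n * coeff G m else 0)"
          using F[of i] G[of "n + m - i"] by (cases i n rule: linorder_cases) auto
      qed auto
      also have "\<dots> = coeff F n * coeff G m" by simp
      finally show ?thesis .
    qed
    moreover have "coeff (F * G) k = 0" if "k > n + m" for k
      using degree_mult_le[of F G] dF dG that by (intro coeff_eq_0) linarith
    ultimately show ?thesis using nm by (auto simp: s_coeff_def nat_add_distrib)
  qed
  then show "s_coeff (F * G) (N + M) = s_coeff F N * s_coeff G M" "K > N + M \<Longrightarrow> s_coeff (F * G) K = 0" by auto
qed

lemma fls_mult_lead:
  fixes a b :: "'k::field fls"
  assumes "\<And>i. i < J \<Longrightarrow> a $$ i = 0" "\<And>i. i < L \<Longrightarrow> b $$ i = 0"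
  shows "(a * b) $$ (J + L) = a $$ J * b $$ L" "i < J + L \<Longrightarrow> (a * b) $$ i = 0"
proof -
  have "(a * b) $$ (J + L) = a $$ J * b $$ L \<and> (i < J + L \<longrightarrow> (a * b) $$ i = 0)"
  proof (cases "a = 0 \<or> b = 0")
    case False
    then have sub: "J \<le> fls_subdegree a" "L \<le> fls_subdegree b"
      using assms by (auto intro!: fls_subdegree_geI)
    have "(a * b) $$ (J + L) = (\<Sum>i=fls_subdegree a..J + L - fls_subdegree b. a $$ i * b $$ (J + L - i))"
      by (rule fls_times_nth(2))
    also have "\<dots> = a $$ J * b $$ L"
    proof (cases "fls_subdegree a = J \<and> fls_subdegree b = L")
      case False
      then have "fls_subdegree a > J + L - fls_subdegree b" using sub by auto
      moreover have "a $$ J * b $$ L = 0" using False sub by auto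
      ultimately show ?thesis by simp
    qed auto
    finally show ?thesis using sub by (auto intro: fls_times_nth_eq0)
  qed auto
  then show "(a * b) $$ (J + L) = a $$ J * b $$ L" "i < J + L \<Longrightarrow> (a * b) $$ i = 0" by auto
qed

lemma lead_mult:
  assumes "lead F N J u" "lead G M L v"
  shows "lead (F * G) (N + M) (J + L) (u * v)"
  unfolding lead_def
proof (intro conjI allI impI)
  have F: "\<And>N'. N' > N \<Longrightarrow> s_coeff F N' = 0" "\<And>i. i < J \<Longrightarrow> s_coeff F N $$ i = 0" "s_coeff F N $$ J = u"
    using assms(1) by (auto simp: lead_def)
  have G: "\<And>N'. N' > M \<Longrightarrow> s_coeff G N' = 0" "\<And>i. i < L \<Longrightarrow> s_coeff G M $$ i = 0" "s_coeff G M $$ L = v"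
    using assms(2) by (auto simp: lead_def)
  note t = s_coeff_mult[OF F(1) G(1)]
  show "s_coeff (F * G) N' = 0" if "N' > N + M" for N' by (rule t(2)) (use that in auto)
  have eq: "s_coeff (F * G) (N + M) = s_coeff F N * s_coeff G M" by (rule t(1)) auto
  show "s_coeff (F * G) (N + M) $$ i = 0" if "i < J + L" for i
    unfolding eq by (rule fls_mult_lead(2)[OF F(2) G(2) that])
  show "s_coeff (F * G) (N + M) $$ (J + L) = u * v"
    unfolding eq using fls_mult_lead(1)[OF F(2) G(2)] F(3) G(3) by simp
qed

lemma lead_power: "lead F N J u \<Longrightarrow> lead (F ^ i) (int i * N) (int i * J) (u ^ i)"
proof (induction i)
  case 0
  show ?case by (auto simp: lead_def s_coeff_def)
next
  case (Suc i)
  then show ?case using lead_mult[OF Suc.prems Suc.IH[OF Suc.prems]] by (simp add: algebra_simps)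
qed

lemma lead_exists:
  assumes "F \<noteq> 0"
  obtains N J u where "lead F N J u" "u \<noteq> 0"
proof -
  have "lead_coeff F \<noteq> 0" using assms by simp
  then have "lead F (int (degree F)) (fls_subdegree (lead_coeff F)) (lead_coeff F $$ fls_subdegree (lead_coeff F))"
    by (auto simp: lead_def s_coeff_def coeff_eq_0)
  then show ?thesis using that \<open>lead_coeff F \<noteq> 0\<close> by (metis nth_fls_subdegree_nonzero)
qed

section \<open>Partial derivatives of $k((x))[s]$\<close>

definition x_deriv :: "'k::field_char_0 fls poly \<Rightarrow> 'k fls poly" where "x_deriv = map_poly fls_deriv"

lemma coeff_x_deriv: "coeff (x_deriv F) i = fls_deriv (coeff F i)"
  by (simp add: x_deriv_def coeff_map_poly)

lemma x_deriv_add: "x_deriv (F + G) = x_deriv F + x_deriv G"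
  by (rule poly_eqI) (simp add: coeff_x_deriv)

lemma x_deriv_mult: "x_deriv (F * G) = F * x_deriv G + x_deriv F * G"
  by (rule poly_eqI) (simp add: coeff_x_deriv coeff_mult fls_deriv_sum sum.distrib)

lemma lead_x_deriv: "lead F N J u \<Longrightarrow> lead (x_deriv F) N (J - 1) (of_int J * u)"
proof -
  assume "lead F N J u"
  moreover have "s_coeff (x_deriv F) M = fls_deriv (s_coeff F M)" for M
    by (simp add: s_coeff_def coeff_x_deriv)
  ultimately show ?thesis by (simp add: lead_def)
qed

lemma lead_pderiv: "lead F N J u \<Longrightarrow> lead (pderiv F) (N - 1) J (of_int N * u)"
proof -
  assume l: "lead F N J u"
  have s_coeff: "s_coeff (pderiv F) M = of_int (M + 1) * s_coeff F (M + 1)" for M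
  proof -
    consider "M < -1" | "M = -1" | i where "M = int i"
      using nonneg_int_cases[of M] by force
    then show ?thesis
    proof cases
      case 3
      then show ?thesis by (simp add: s_coeff_def coeff_pderiv nat_add_distrib algebra_simps)
    qed (simp_all add: s_coeff_def)
  qed
  then show ?thesis using l by (simp add: lead_def s_coeff fls_of_int)
qed

section \<open>The weights of a homogeneous locally nilpotent derivation\<close>

text \<open>
  The highest order of a pole in \<open>x\<close> that the leading coefficient of an element of \<open>R\<close> of \<open>s\<close>-degree \<open>N\<close> can have.
\<close>

definition ord_bound :: "nat \<Rightarrow> nat \<Rightarrow> nat \<Rightarrow> nat \<Rightarrow> int \<Rightarrow> int" where
  "ord_bound n e d m N = int n * (N div int d) + int e * (N div (int d * int m))"

definition in_cone :: "nat \<Rightarrow> nat \<Rightarrow> nat \<Rightarrow> nat \<Rightarrow> int \<Rightarrow> int \<Rightarrow> bool" where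
  "in_cone n e d m N J \<longleftrightarrow> N \<ge> 0 \<and> J \<ge> - ord_bound n e d m N"

text \<open>
  Here \<open>tx\<close>, \<open>ts\<close>, \<open>ty\<close> are the numbers of steps \<open>(b, a)\<close> after which the leading exponents of \<open>x\<close>, \<open>s\<close>, \<open>y\<close>
  are annihilated, and the left hand side of \<open>tz\<close> is this number for \<open>z\<close>. They are the values of one linear form,
  which takes the value \<open>-1\<close> on the step. If \<open>tx\<close> were positive, then the path that starts in \<open>x\<close> would force
  the linear form to vanish on the edge of the cone spanned by \<open>z\<close>. So the step points out of the cone, and
  \<open>-a > ord_bound b\<close>, while the first step from \<open>s\<close> stays inside and gives \<open>-a \<le> ord_bound (b + 1)\<close>. Hence the
  staircase \<open>ord_bound\<close> jumps between \<open>b\<close> and \<open>b + 1\<close>, and the bounds on \<open>-a\<close> from the first steps of \<open>x\<close>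
  and, for \<open>e > 0\<close>, of \<open>y\<close> contradict the slope of the edge.
\<close>

lemma weight_of_x_zero:
  fixes a b :: int and tx ts ty :: nat
  assumes n: "n \<ge> 1" and ne: "(n, e) \<noteq> (1, 0)" and d: "d \<ge> 2" and m: "m \<ge> 2"
    and root: "int tx * a + int ts * b = -1"
    and ty: "int ty = int d * int ts - int n * int tx"
    and tz: "int d * int m * int ts - (int n * int m + int e) * int tx \<ge> 0"
    and x: "\<And>t. t \<le> tx \<Longrightarrow> in_cone n e d m (int t * b) (1 + int t * a)"
    and s: "\<And>t. t \<le> ts \<Longrightarrow> in_cone n e d m (1 + int t * b) (int t * a)"
    and y: "\<And>t. t \<le> ty \<Longrightarrow> in_cone n e d m (int d + int t * b) (- int n + int t * a)"
  shows "tx = 0"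
proof (rule ccontr)
  assume "tx \<noteq> 0"
  then have tx: "tx \<ge> 1" by simp
  define M V A where "M = int d * int m" and "V = int n * int m + int e" and "A = - a"
  let ?phi = "ord_bound n e d m"
  have M: "M > 0" and V: "V > 0" using n d m by (auto simp: M_def V_def add_pos_nonneg)
  \<comment> \<open>The staircase lies below the line through the origin and the exponent of \<open>z\<close>.\<close>
  have phi_le: "M * ?phi N \<le> V * N" if "N \<ge> 0" for N
  proof -
    have "M * ?phi N = int n * int m * (int d * (N div int d)) + int e * (M * (N div M))"
      by (simp add: ord_bound_def M_def algebra_simps)
    also have "\<dots> \<le> int n * int m * N + int e * N"
      using d M by (intro add_mono mult_left_mono) (auto simp: minus_mod_eq_mult_div[symmetric])
    finally show ?thesis by (simp add: V_def algebra_simps)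
  qed
  have MV: "M * int ts \<ge> V * int tx" using tz by (simp add: M_def V_def)
  then have ts: "ts \<ge> 1" using V tx by (cases "ts = 0") (auto simp: mult_le_0_iff)
  have x1: "b \<ge> 0" "A \<le> 1 + ?phi b" using x[of 1] tx by (auto simp: in_cone_def A_def)
  have s1: "A \<le> ?phi (b + 1)" using s[of 1] ts by (auto simp: in_cone_def A_def algebra_simps)
  have txA: "int tx * A = 1 + int ts * b" using root by (simp add: A_def)
  then have "int tx * A > 0" using x1(1) by (simp add: add_pos_nonneg)
  then have A: "A > 0" using tx by (simp add: zero_less_mult_iff)
  have b: "b > 0"
  proof (rule ccontr)
    assume "\<not> b > 0"
    then have "b = 0" using x1 by simp
    then have "?phi (b + 1) = 0" using d m by (simp add: ord_bound_def div_pos_pos_trivial less_1_mult)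
    then show False using s1 A by simp
  qed
  \<comment> \<open>The path that starts in \<open>x\<close> ends on the zero line of the linear form inside the cone, so this line is the edge.\<close>
  have eq: "M * int ts = V * int tx"
  proof -
    have "in_cone n e d m (int tx * b) (1 + int tx * a)" using x[of tx] by simp
    then have "int tx * A - 1 \<le> ?phi (int tx * b)" by (simp add: in_cone_def A_def)
    then have "M * (int ts * b) \<le> M * ?phi (int tx * b)" using M txA by simp
    also have "\<dots> \<le> V * (int tx * b)" using b by (intro phi_le) simp
    finally have "(M * int ts) * b \<le> (V * int tx) * b" by (simp add: mult.assoc)
    then show ?thesis using b MV by simp
  qed
  have MA: "M * A > V * b"
  proof -
    have "int tx * (M * A) = M * (1 + int ts * b)" by (simp add: txA[symmetric])
    also have "\<dots> = M + (M * int ts) * b" by (simp add: algebra_simps)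
    also have "\<dots> = M + int tx * (V * b)" unfolding eq by (simp add: algebra_simps)
    finally have "int tx * (V * b) < int tx * (M * A)" using M by simp
    then show ?thesis using tx by simp
  qed
  have "M * ?phi b < M * A" using phi_le[of b] b MA by simp
  then have "?phi b < A" using M by simp
  with s1 have jump: "?phi b < ?phi (b + 1)" by simp
  \<comment> \<open>The staircase is constant between multiples of \<open>d\<close>.\<close>
  have "int d dvd b + 1"
  proof (rule ccontr)
    assume nd: "\<not> int d dvd b + 1"
    have "(b + 1) div int d = b div int d"
    proof -
      have "(b + 1) mod int d \<noteq> 0" using nd by (simp add: dvd_eq_mod_eq_0)
      then have "0 \<le> (b + 1) mod int d - 1" "(b + 1) mod int d - 1 < int d"
        using pos_mod_sign[of "int d" "b + 1"] pos_mod_bound[of "int d" "b + 1"] d by linarith+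
      moreover have "b = int d * ((b + 1) div int d) + ((b + 1) mod int d - 1)"
        by (simp add: algebra_simps)
      ultimately show ?thesis by (metis int_div_pos_eq)
    qed
    moreover have "(b + 1) div (int d * int m) = b div (int d * int m)"
      using calculation by (simp add: zdiv_zmult2_eq)
    ultimately show False using jump by (simp add: ord_bound_def)
  qed
  then obtain q where q: "b = int d * q - 1" by (metis add_diff_cancel_right' dvdE)
  have divs: "b div int d = q - 1" "(b + int d) div int d = q"
  proof -
    show "b div int d = q - 1" using d q by (intro int_div_pos_eq[of _ _ _ "int d - 1"]) (auto simp: algebra_simps)
    then show "(b + int d) div int d = q" using d by (simp add: div_add_self2)
  qed
  have floor_m: "int m * (t div int m) \<le> t" for t
    using m by (simp add: minus_mod_eq_mult_div[symmetric])
  have "int m * A \<le> int m * (1 + ?phi b)" using x1 m by simp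
  also have "\<dots> = int m + int n * int m * (q - 1) + int e * (int m * ((q - 1) div int m))"
    by (simp add: ord_bound_def zdiv_zmult2_eq divs algebra_simps)
  also have "\<dots> \<le> int m + int n * int m * (q - 1) + int e * (q - 1)"
    by (intro add_left_mono mult_left_mono floor_m) simp
  also have "\<dots> = int m + V * (q - 1)" by (simp add: V_def algebra_simps)
  \<comment> \<open>The bound from the first step of \<open>x\<close>; it is already contradictory for \<open>e = 0\<close>, where \<open>n \<ge> 2\<close>.\<close>
  finally have "int d * (int m * A) \<le> int d * (int m + V * (q - 1))" by (rule mult_left_mono) simp
  with MA q have bound1: "V * (int d - 1) < int d * int m"
    by (simp add: M_def algebra_simps)
  show False
  proof (cases "e = 0")
    case True
    then have n2: "int n \<ge> 2" using n ne by auto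
    have "int m * (int n * (int d - 1)) < int m * int d"
      using bound1 True by (simp add: V_def algebra_simps)
    then have "int n * (int d - 1) < int d" using m by (simp add: mult_less_cancel_left)
    moreover have "2 * (int d - 1) \<le> int n * (int d - 1)" using n2 d by (intro mult_right_mono) auto
    ultimately show False using d by simp
  next
    case False
    have "int m * int ty = int e * int tx"
      using eq by (simp add: ty M_def V_def algebra_simps)
    then have "int m * int ty > 0" using False tx by simp
    then have "ty \<ge> 1" by (cases ty) auto
    then have "A + int n \<le> ?phi (b + int d)" using y[of 1] by (simp add: in_cone_def A_def add.commute)
    then have "int m * (A + int n) \<le> int m * ?phi (b + int d)" using m by simp
    also have "\<dots> = int n * int m * q + int e * (int m * (q div int m))"
      by (simp only: ord_bound_def zdiv_zmult2_eq divs of_nat_0_le_iff) (simp add: algebra_simps)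
    also have "\<dots> \<le> int n * int m * q + int e * q"
      by (intro add_left_mono mult_left_mono floor_m) simp
    finally have "int d * (int m * (A + int n)) \<le> int d * (int n * int m * q + int e * q)"
      by (rule mult_left_mono) simp
    with MA q have bound2: "V > int d * int m * int n"
      by (simp add: M_def V_def algebra_simps)
    have "int d * int m * int n * (int d - 1) \<le> V * (int d - 1)"
      using bound2 d by (intro mult_right_mono) auto
    also note bound1
    finally have "int d * int m * (int n * (int d - 1)) < int d * int m * 1"
      by (simp add: algebra_simps)
    then have "int n * (int d - 1) < 1" using d m by (simp add: mult_less_cancel_left)
    moreover have "int n * (int d - 1) > 0" using n d by simp
    ultimately show False by simp
  qed
qed

section \<open>Evaluation homomorphisms\<close>

text \<open>
  Homomorphisms between the type-class rings \<open>k[X]\<close>, \<open>k[X][Y]\<close>, \<open>k[X][Y][Z]\<close> and \<open>k((x))[s]\<close>.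
\<close>

definition ring_morphism :: "('a::comm_ring_1 \<Rightarrow> 'b::comm_ring_1) \<Rightarrow> bool" where
  "ring_morphism h \<longleftrightarrow> h 1 = 1 \<and> (\<forall>a b. h (a + b) = h a + h b) \<and> (\<forall>a b. h (a * b) = h a * h b)"

lemma ring_morphismD:
  assumes "ring_morphism h"
  shows "h 1 = 1" "h (a + b) = h a + h b" "h (a * b) = h a * h b" "h 0 = 0"
    "h (- a) = - h a" "h (a - b) = h a - h b" "h (a ^ i) = h a ^ i" "h (sum u A) = (\<Sum>i\<in>A. h (u i))"
proof -
  show 1: "h 1 = 1" and add: "h (a + b) = h a + h b" and mult: "h (a * b) = h a * h b" for a b
    using assms by (auto simp: ring_morphism_def)
  show 0: "h 0 = 0" using add[of 0 0] by simp
  show minus: "h (- a) = - h a" for a using add[of a "- a"] 0 by (simp add: eq_neg_iff_add_eq_0 add.commute)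
  show "h (a - b) = h a - h b" using add[of a "- b"] minus by simp
  show "h (a ^ i) = h a ^ i" by (induction i) (simp_all add: 1 mult)
  show "h (sum u A) = (\<Sum>i\<in>A. h (u i))" by (induction A rule: infinite_finite_induct) (simp_all add: 0 add)
qed

definition eval_poly :: "('a::comm_ring_1 \<Rightarrow> 'b::comm_ring_1) \<Rightarrow> 'b \<Rightarrow> 'a poly \<Rightarrow> 'b" where
  "eval_poly h t p = poly (map_poly h p) t"

lemma eval_poly_pCons:
  "ring_morphism h \<Longrightarrow> eval_poly h t (pCons c p) = h c + t * eval_poly h t p"
  by (cases "c = 0 \<and> p = 0") (auto simp: eval_poly_def map_poly_pCons ring_morphismD)

lemma eval_poly_0 [simp]: "eval_poly h t 0 = 0"
  by (simp add: eval_poly_def)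

lemma eval_poly_const: "ring_morphism h \<Longrightarrow> eval_poly h t [:c:] = h c"
  by (simp add: eval_poly_pCons)

lemma eval_poly_var: "ring_morphism h \<Longrightarrow> eval_poly h t [:0, 1:] = t"
  by (simp add: eval_poly_pCons ring_morphismD)

lemma ring_morphism_eval_poly:
  assumes h: "ring_morphism h"
  shows "ring_morphism (eval_poly h t)"
proof -
  have add: "eval_poly h t (p + q) = eval_poly h t p + eval_poly h t q" for p q
    by (induction p q rule: poly_induct2)
      (simp_all add: eval_poly_pCons[OF h] ring_morphismD[OF h] algebra_simps)
  have smult: "eval_poly h t (smult c p) = h c * eval_poly h t p" for c p
    by (induction p) (simp_all add: eval_poly_pCons[OF h] ring_morphismD[OF h] algebra_simps)
  have "eval_poly h t (p * q) = eval_poly h t p * eval_poly h t q" for p q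
    by (induction p) (simp_all add: add smult eval_poly_pCons[OF h] ring_morphismD[OF h] algebra_simps)
  moreover have "eval_poly h t 1 = 1"
    unfolding one_pCons eval_poly_const[OF h] by (rule ring_morphismD(1)[OF h])
  ultimately show ?thesis using add by (simp add: ring_morphism_def)
qed

text \<open>
  Substitution commutes with homomorphisms; this computes the images of \<open>P(X,S)\<close> and \<open>Q(X,Y)\<close> in \<open>R\<close>.
\<close>

lemma ring_morphism_comp_eval_poly:
  assumes "ring_morphism g" "ring_morphism h"
  shows "g (eval_poly h t p) = eval_poly (\<lambda>c. g (h c)) (g t) p"
proof -
  have gh: "ring_morphism (\<lambda>c. g (h c))"
    using assms by (simp add: ring_morphism_def)
  show ?thesis
    by (induction p) (simp_all add: eval_poly_pCons[OF assms(2)] eval_poly_pCons[OF gh] ring_morphismD[OF assms(1)])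
qed

lemma eval_poly_monom: "ring_morphism h \<Longrightarrow> eval_poly h t (monom c i) = h c * t ^ i"
  by (simp add: eval_poly_def map_poly_monom ring_morphismD poly_monom)

lemma eval_poly_monic:
  assumes "ring_morphism h"
  shows "eval_poly h t (monom 1 k + (\<Sum>i<k. monom (c i) i)) = t ^ k + (\<Sum>i<k. h (c i) * t ^ i)"
  using assms ring_morphism_eval_poly[OF assms] by (simp add: ring_morphismD eval_poly_monom)

section \<open>The subring $k[x,x^{-1},s]$\<close>

definition emb :: "'k::field_char_0 poly \<Rightarrow> 'k fls poly" where
  "emb p = [:fps_to_fls (fps_of_poly p):]"

definition xpow :: "int \<Rightarrow> 'k::field_char_0 fls poly" where
  "xpow i = [:fls_X_intpow i:]"

definition sT :: "'k::field_char_0 fls poly" where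
  "sT = [:0, 1:]"

lemma ring_morphism_emb: "ring_morphism emb"
  by (simp add: ring_morphism_def emb_def fps_of_poly_add fps_of_poly_mult fls_times_fps_to_fls one_pCons)

lemmas emb_simps = ring_morphismD[OF ring_morphism_emb]

lemma xpow_add: "xpow i * xpow j = xpow (i + j)"
  by (simp add: xpow_def fls_X_intpow_times_fls_X_intpow add.commute)

lemma xpow_0: "xpow 0 = 1"
  by (simp add: xpow_def one_pCons)

lemma emb_X_power: "emb [:0, 1:] ^ i = xpow (int i)"
proof -
  have 1: "emb [:0, 1:] = xpow 1"
    by (simp add: emb_def xpow_def fls_X_conv_shift_1)
  show ?thesis
    by (induction i) (simp_all add: 1 xpow_0 xpow_add)
qed

lemma emb_lead:
  assumes "p \<noteq> 0"
  obtains J v where "J \<ge> 0" "v \<noteq> 0" "lead (emb p) 0 J v"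
proof -
  have "emb p \<noteq> 0" using assms fps_of_poly_eq_iff[of p 0] by (simp add: emb_def)
  then obtain N J v where l: "lead (emb p) N J v" "v \<noteq> 0" by (rule lead_exists)
  have "N = 0"
    using leadD(3)[OF l(1)] l(2) by (auto simp: s_coeff_def emb_def coeff_pCons split: if_splits nat.splits)
  moreover have "J \<ge> 0"
    using leadD(3)[OF l(1)] l(2) \<open>N = 0\<close> by (auto simp: s_coeff_def emb_def split: if_splits)
  ultimately show ?thesis using that l by blast
qed

lemma emb_eq_iff: "emb p = emb q \<longleftrightarrow> p = q"
  by (simp add: emb_def fps_of_poly_eq_iff)

lemma lead_xpow: "lead (xpow i) 0 i 1"
  by (auto simp: lead_def s_coeff_def xpow_def coeff_pCons split: nat.splits)

lemma lead_sT: "lead sT 1 0 1"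
  by (auto simp: lead_def s_coeff_def sT_def coeff_pCons split: nat.splits)

lemma lead_sum: "(\<And>i. i \<in> A \<Longrightarrow> lead (F i) N J 0) \<Longrightarrow> lead (\<Sum>i\<in>A. F i) N J 0"
proof (induction A rule: infinite_finite_induct)
  case (insert x A)
  then show ?case using lead_add[of "F x" N J 0 "sum F A" 0] by simp
qed (simp_all add: lead_0)

text \<open>
  Only the top power matters, because coefficients in \<open>k[x]\<close> do not contribute to the \<open>s\<close>-degree. Applied to
  \<open>P(x,s)\<close> and \<open>Q(x,y)\<close>, this gives the leading terms of \<open>y\<close> and \<open>z\<close>.
\<close>

lemma lead_monic:
  assumes "lead T N J 1" "N > 0"
  shows "lead (T ^ k + (\<Sum>i<k. emb (c i) * T ^ i)) (int k * N) (int k * J) 1"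
proof -
  have "lead (\<Sum>i<k. emb (c i) * T ^ i) (int k * N) (int k * J) 0"
  proof (rule lead_sum)
    fix i assume i: "i \<in> {..<k}"
    show "lead (emb (c i) * T ^ i) (int k * N) (int k * J) 0"
    proof (cases "c i = 0")
      case True
      then show ?thesis by (simp add: emb_simps lead_0)
    next
      case False
      then obtain L v where "lead (emb (c i)) 0 L v" by (rule emb_lead)
      from lead_mult[OF this lead_power[OF assms(1), of i]] show ?thesis
        by (rule lead_weaken) (use i assms(2) in simp)
    qed
  qed
  from lead_add[OF lead_power[OF assms(1), of k] this] show ?thesis by simp
qed

lemma lead_negative: "lead F N J u \<Longrightarrow> N < 0 \<Longrightarrow> F = 0"
proof (rule poly_eqI)
  fix i assume "lead F N J u" "N < 0"
  then show "coeff F i = coeff 0 i" using leadD(1)[of F N J u "int i"] by (simp add: s_coeff_def)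
qed

lemma emb_const: "emb [:c:] = [:fls_const c:]"
  by (simp add: emb_def fps_of_poly_const)

lemma x_deriv_emb_const: "x_deriv (emb [:c:]) = 0" and pderiv_emb: "pderiv (emb p) = 0"
  by (simp add: x_deriv_def emb_const map_poly_pCons) (simp add: emb_def pderiv_pCons)

lemma emb_pCons: "emb (pCons c p) = emb [:c:] + xpow 1 * emb p"
proof -
  have "pCons c p = [:c:] + [:0, 1:] * p" by simp
  then show ?thesis using emb_X_power[of 1, where 'a = 'a] by (simp only: emb_simps) simp
qed

lemma partial_derivatives_vars: "x_deriv (xpow 1) = 1" "pderiv (xpow i) = 0" "x_deriv sT = 0" "pderiv sT = 1"
  by (simp_all add: x_deriv_def xpow_def sT_def map_poly_pCons pderiv_pCons one_pCons fls_X_conv_shift_1[symmetric])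

lemma xpow_nonzero: "xpow i \<noteq> 0"
  by (simp add: xpow_def)

lemma pderiv_eval_poly: "pderiv (eval_poly emb t A) = eval_poly emb t (pderiv A) * pderiv t"
proof (induction A)
  case (pCons a A)
  note E = ring_morphism_eval_poly[OF ring_morphism_emb, of t]
  have "eval_poly emb t (pCons 0 (pderiv A)) = t * eval_poly emb t (pderiv A)"
    by (simp add: eval_poly_pCons ring_morphism_emb emb_simps)
  then show ?case using pCons
    by (simp add: eval_poly_pCons ring_morphism_emb pderiv_add pderiv_mult pderiv_emb pderiv_pCons
        ring_morphismD[OF E] algebra_simps)
qed simp

lemma funpow_pderiv_degree: "degree F < i \<Longrightarrow> (pderiv ^^ i) F = 0"
  for F :: "'a::{comm_semiring_1,semiring_no_zero_divisors,semiring_char_0} poly"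
proof (induction i arbitrary: F)
  case (Suc i)
  show ?case
  proof (cases "degree F = 0")
    case True
    then obtain c where "F = [:c:]" by (rule degree_eq_zeroE)
    then have "pderiv F = 0" by (simp add: pderiv_pCons)
    moreover have "(pderiv ^^ i) (0 :: 'a poly) = 0" by (induction i) simp_all
    ultimately show ?thesis by (simp add: funpow_Suc_right del: funpow.simps)
  next
    case False
    then show ?thesis using Suc by (simp add: degree_pderiv funpow_Suc_right del: funpow.simps)
  qed
qed simp

section \<open>The embedding of $R$ into $k((x))[s]$\<close>

locale double_danielewski =
  fixes n e d m :: nat and f g :: "nat \<Rightarrow> 'k::field_char_0 poly" and P Q :: "'k poly poly"
  assumes n: "n \<ge> 1" and ne: "(n, e) \<noteq> (1, 0)" and d: "d \<ge> 2" and m: "m \<ge> 2"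
    and P: "P = monom 1 d + (\<Sum>i<d. monom (f i) i)"
    and Q: "Q = monom 1 m + (\<Sum>j<m. monom (g j) j)"
begin

definition yT :: "'k fls poly" where
  "yT = xpow (- int n) * eval_poly emb sT P"

definition zT :: "'k fls poly" where
  "zT = xpow (- int e) * (eval_poly emb yT Q - sT)"

lemma lead_yT: "lead yT (int d) (- int n) 1"
proof -
  have "lead (eval_poly emb sT P) (int d) 0 1"
    using lead_monic[OF lead_sT, of d f] by (simp add: P eval_poly_monic ring_morphism_emb)
  from lead_mult[OF lead_xpow this, of "- int n"] show ?thesis by (simp add: yT_def)
qed

lemma lead_zT: "lead zT (int (d * m)) (- int (n * m + e)) 1"
proof -
  have "lead (eval_poly emb yT Q) (int (d * m)) (- int (n * m)) 1"
    using lead_monic[OF lead_yT, of m g] d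
    by (simp add: Q eval_poly_monic ring_morphism_emb mult.commute)
  moreover have "lead (- sT) (int (d * m)) (- int (n * m)) (0 :: 'k)"
  proof -
    have "1 < int (d * m)" using mult_le_mono[OF d m] by linarith
    moreover have "lead (- sT) 1 0 (- 1 :: 'k)"
      using lead_sT[where 'a = 'k] by (simp add: lead_def s_coeff_def)
    ultimately show ?thesis by (intro lead_weaken[of "- sT" 1 0]) blast+
  qed
  ultimately have "lead (eval_poly emb yT Q - sT) (int (d * m)) (- int (n * m)) 1"
    using lead_add by fastforce
  from lead_mult[OF lead_xpow this, of "- int e"] show ?thesis
    by (simp add: zT_def add.commute[of "int n * int m"])
qed

text \<open>
  The homomorphism \<open>X \<mapsto> x\<close>, \<open>Y \<mapsto> y\<close>, \<open>Z \<mapsto> z\<close> from \<open>k[X,Y,Z]\<close>; its image is isomorphic to \<open>R\<close>.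
\<close>

definition psi :: "'k poly3 \<Rightarrow> 'k fls poly" where
  "psi = eval_poly (eval_poly emb yT) zT"

lemma ring_morphism_psi: "ring_morphism psi"
  unfolding psi_def by (intro ring_morphism_eval_poly ring_morphism_emb)

lemmas psi_simps = ring_morphismD[OF ring_morphism_psi]

lemma psi_vars: "psi (inX p) = emb p" "psi varX = xpow 1" "psi varY = yT" "psi varZ = zT"
proof -
  note h = ring_morphism_emb ring_morphism_eval_poly[OF ring_morphism_emb]
  show i: "psi (inX p) = emb p" for p
    by (simp add: psi_def inX_def eval_poly_const h)
  show "psi varX = xpow 1"
    using i[of "[:0, 1:]"] emb_X_power[of 1, where 'a = 'k] by (simp add: inX_def varX_def)
  show "psi varY = yT"
    by (simp add: psi_def varY_def eval_poly_const eval_poly_var h)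
  show "psi varZ = zT"
    by (simp add: psi_def varZ_def eval_poly_var h)
qed

lemma ring_morphism_inX: "ring_morphism inX"
  by (simp add: ring_morphism_def inX_def one_pCons)

lemma psi_subst2: "psi (subst2 A T) = eval_poly emb (psi T) A"
  using ring_morphism_comp_eval_poly[OF ring_morphism_psi ring_morphism_inX, of T A]
  by (simp add: subst2_def eval_poly_def psi_vars)

lemma xpow_power: "xpow 1 ^ i = (xpow (int i) :: 'k fls poly)"
  using emb_X_power[of 1, where 'a = 'k] emb_X_power[of i, where 'a = 'k] by simp

lemma psi_polS: "psi (polS e Q) = sT"
proof -
  have "xpow (int e) * zT = eval_poly emb yT Q - sT"
    by (simp add: zT_def mult.assoc[symmetric] xpow_add xpow_0)
  then show ?thesis by (simp add: polS_def psi_simps psi_subst2 psi_vars xpow_power)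
qed

lemma psi_rel: "psi (rel_poly n e P Q) = 0"
proof -
  have "xpow (int n) * yT = eval_poly emb sT P"
    by (simp add: yT_def mult.assoc[symmetric] xpow_add xpow_0)
  then show ?thesis by (simp add: rel_poly_def psi_simps psi_subst2 psi_vars xpow_power psi_polS)
qed

section \<open>Normal forms and leading exponents of $R$\<close>

text \<open>
  The monomials \<open>S\<^sup>i Y\<^sup>j Z\<^sup>k\<close> with \<open>i < d\<close> and \<open>j < m\<close>, enumerated by the \<open>s\<close>-degree \<open>N = i + dj + dmk\<close> of their
  images.
\<close>

definition basis :: "nat \<Rightarrow> 'k poly3" where
  "basis N = polS e Q ^ (N mod d) * varY ^ (N div d mod m) * varZ ^ (N div (d * m))"

definition reducible :: "'k poly3 \<Rightarrow> bool" where
  "reducible F \<longleftrightarrow> (\<exists>K c. rel_poly n e P Q dvd F - (\<Sum>N<K. inX (c N) * basis N))"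

lemma reducibleI: "rel_poly n e P Q dvd F - (\<Sum>N<K. inX (c N) * basis N) \<Longrightarrow> reducible F"
  unfolding reducible_def by (intro exI)

lemma reducible_cong:
  assumes "reducible F" "rel_poly n e P Q dvd G - F"
  shows "reducible G"
proof -
  obtain K c where "rel_poly n e P Q dvd F - (\<Sum>N<K. inX (c N) * basis N)"
    using assms(1) by (auto simp: reducible_def)
  from dvd_add[OF assms(2) this] have "rel_poly n e P Q dvd G - (\<Sum>N<K. inX (c N) * basis N)"
    by simp
  then show ?thesis by (rule reducibleI)
qed

lemma reducible_add:
  assumes "reducible F" "reducible G"
  shows "reducible (F + G)"
proof -
  obtain K c where F: "rel_poly n e P Q dvd F - (\<Sum>N<K. inX (c N) * basis N)"
    using assms(1) by (auto simp: reducible_def)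
  obtain L b where G: "rel_poly n e P Q dvd G - (\<Sum>N<L. inX (b N) * basis N)"
    using assms(2) by (auto simp: reducible_def)
  let ?a = "\<lambda>N. (if N < K then c N else 0) + (if N < L then b N else 0)"
  have ext: "(\<Sum>N<max K L. inX (if N < M then w N else 0) * basis N) = (\<Sum>N<M. inX (w N) * basis N)"
    if "M \<le> max K L" for M w
    by (rule sum.mono_neutral_cong_right) (use that in \<open>auto simp: inX_def\<close>)
  have "(\<Sum>N<max K L. inX (?a N) * basis N) = (\<Sum>N<K. inX (c N) * basis N) + (\<Sum>N<L. inX (b N) * basis N)"
    by (simp only: ring_morphismD(2)[OF ring_morphism_inX] distrib_right sum.distrib)
      (simp add: ext)
  then have "(F + G) - (\<Sum>N<max K L. inX (?a N) * basis N) =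
      (F - (\<Sum>N<K. inX (c N) * basis N)) + (G - (\<Sum>N<L. inX (b N) * basis N))"
    by simp
  then have "rel_poly n e P Q dvd (F + G) - (\<Sum>N<max K L. inX (?a N) * basis N)"
    using dvd_add[OF F G] by (simp only:)
  then show ?thesis by (rule reducibleI)
qed

lemma reducible_0: "reducible 0"
  unfolding reducible_def by (intro exI[of _ 0]) simp

lemma reducible_inX:
  assumes "reducible F"
  shows "reducible (inX p * F)"
proof -
  obtain K c where F: "rel_poly n e P Q dvd F - (\<Sum>N<K. inX (c N) * basis N)"
    using assms(1) by (auto simp: reducible_def)
  have "rel_poly n e P Q dvd inX p * (F - (\<Sum>N<K. inX (c N) * basis N))"
    by (rule dvd_mult[OF F])
  also have "inX p * (F - (\<Sum>N<K. inX (c N) * basis N)) = inX p * F - (\<Sum>N<K. inX (p * c N) * basis N)"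
    by (simp add: sum_distrib_left ring_morphismD[OF ring_morphism_inX] algebra_simps)
  finally show ?thesis by (rule reducibleI)
qed

lemma reducible_sum: "(\<And>i. i \<in> A \<Longrightarrow> reducible (F i)) \<Longrightarrow> reducible (\<Sum>i\<in>A. F i)"
  by (induction A rule: infinite_finite_induct) (auto intro: reducible_add reducible_0)

lemma reducible_minus: "reducible F \<Longrightarrow> reducible (- F)"
  using reducible_inX[of F "- 1"]
  by (simp add: ring_morphismD[OF ring_morphism_inX])

lemma reducible_basis: "reducible (basis N)"
proof -
  have "(\<Sum>M<Suc N. inX (if M = N then 1 else 0) * basis M) = basis N"
    by (simp add: ring_morphismD[OF ring_morphism_inX])
  then show ?thesis unfolding reducible_def
    by (intro exI[of _ "Suc N"] exI[of _ "\<lambda>M. if M = N then 1 else 0"]) simp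
qed

lemma subst2_monic: 
  "subst2 P T = T ^ d + (\<Sum>i<d. inX (f i) * T ^ i)"
  "subst2 Q T = T ^ m + (\<Sum>i<m. inX (g i) * T ^ i)"
  using eval_poly_monic[OF ring_morphism_inX] by (simp_all add: subst2_def P Q eval_poly_def)

lemma varX_power: "(varX :: 'k poly3) ^ i = inX ([:0, 1:] ^ i)"
proof -
  have "(varX :: 'k poly3) = inX [:0, 1:]" by (simp add: varX_def inX_def)
  then show ?thesis by (simp add: ring_morphismD[OF ring_morphism_inX])
qed

text \<open>
  The relation and the definition of \<open>S\<close> give the rewrite rules
  \<open>S\<^sup>d \<rightarrow> X\<^sup>n Y - \<Sum> f\<^sub>i S\<^sup>i\<close> and \<open>Y\<^sup>m \<rightarrow> X\<^sup>e Z + S - \<Sum> g\<^sub>j Y\<^sup>j\<close>. As \<open>d, m \<ge> 2\<close>, both lower the total degree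
  in \<open>S\<close>, \<open>Y\<close> and \<open>Z\<close>.
\<close>

lemma reducible_monomial: "reducible (polS e Q ^ i * varY ^ j * varZ ^ k)"
proof (induction "i + j + k" arbitrary: i j k rule: less_induct)
  case less
  let ?S = "polS e Q"
  consider "d \<le> i" | "i < d" "m \<le> j" | "i < d" "j < m" by linarith
  then show ?case
  proof cases
    case 1
    let ?W = "?S ^ (i - d) * varY ^ j * varZ ^ k"
    let ?G = "inX ([:0, 1:] ^ n) * (?S ^ (i - d) * varY ^ Suc j * varZ ^ k) +
      - (\<Sum>l<d. inX (f l) * (?S ^ (i - d + l) * varY ^ j * varZ ^ k))"
    have G: "reducible ?G"
      using 1 d
      by (intro reducible_add reducible_minus reducible_sum reducible_inX less) auto
    have diff: "?S ^ i * varY ^ j * varZ ^ k - ?G = rel_poly n e P Q * - ?W"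
    proof -
      have "?S ^ i = ?S ^ (i - d) * ?S ^ d" using 1 by (simp flip: power_add)
      then show ?thesis
        by (simp add: rel_poly_def subst2_monic varX_power sum_distrib_left sum_distrib_right power_add algebra_simps)
    qed
    show ?thesis by (rule reducible_cong[OF G]) (unfold diff, rule dvd_triv_left)
  next
    case 2
    let ?W = "?S ^ i * varY ^ (j - m) * varZ ^ k"
    let ?G = "inX ([:0, 1:] ^ e) * (?S ^ i * varY ^ (j - m) * varZ ^ Suc k) +
      ?S ^ Suc i * varY ^ (j - m) * varZ ^ k +
      - (\<Sum>l<m. inX (g l) * (?S ^ i * varY ^ (j - m + l) * varZ ^ k))"
    have G: "reducible ?G"
      using 2 m
      by (intro reducible_add reducible_minus reducible_sum reducible_inX less) auto
    have eq: "?S ^ i * varY ^ j * varZ ^ k = ?G"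
    proof -
      have Y: "varY ^ m = ?S + inX ([:0, 1:] ^ e) * varZ - (\<Sum>l<m. inX (g l) * varY ^ l)"
        by (simp add: polS_def subst2_monic varX_power)
      have "varY ^ j = varY ^ (j - m) * (varY ^ m :: 'k poly3)" using 2 by (simp flip: power_add)
      then have "?S ^ i * varY ^ j * varZ ^ k = ?S ^ i * varY ^ (j - m) * varZ ^ k * varY ^ m"
        by (simp only: mult_ac)
      also have "\<dots> = ?G" unfolding Y
        by (simp add: sum_distrib_left power_add algebra_simps)
      finally show ?thesis .
    qed
    show ?thesis unfolding eq by (rule G)
  next
    case 3
    define N where "N = i + d * (j + m * k)"
    have "N mod d = i" "N div d = j + m * k" using 3 by (simp_all add: N_def)
    moreover have "N div (d * m) = k" using calculation 3 by (simp add: div_mult2_eq)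
    ultimately have "basis N = ?S ^ i * varY ^ j * varZ ^ k" using 3 by (simp add: basis_def)
    then show ?thesis using reducible_basis by metis
  qed
qed

lemma reducible_mult:
  assumes F: "reducible F" and G: "\<And>N. reducible (G * basis N)"
  shows "reducible (G * F)"
proof -
  obtain K c where *: "rel_poly n e P Q dvd F - (\<Sum>N<K. inX (c N) * basis N)"
    using F by (auto simp: reducible_def)
  have "reducible (\<Sum>N<K. inX (c N) * (G * basis N))"
    by (intro reducible_sum reducible_inX G)
  moreover have "G * F - (\<Sum>N<K. inX (c N) * (G * basis N)) = G * (F - (\<Sum>N<K. inX (c N) * basis N))"
    by (simp add: sum_distrib_left algebra_simps)
  ultimately show ?thesis using dvd_mult[OF *, of G]
    by (intro reducible_cong[of "\<Sum>N<K. inX (c N) * (G * basis N)" "G * F"]) (simp_all only:)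
qed

lemma reducible_varY: "reducible F \<Longrightarrow> reducible (varY * F)"
proof (erule reducible_mult)
  fix N
  have "varY * basis N = polS e Q ^ (N mod d) * varY ^ Suc (N div d mod m) * varZ ^ (N div (d * m))"
    by (simp add: basis_def algebra_simps)
  then show "reducible (varY * basis N)" using reducible_monomial by metis
qed

lemma reducible_varZ: "reducible F \<Longrightarrow> reducible (varZ * F)"
proof (erule reducible_mult)
  fix N
  have "varZ * basis N = polS e Q ^ (N mod d) * varY ^ (N div d mod m) * varZ ^ Suc (N div (d * m))"
    by (simp add: basis_def algebra_simps)
  then show "reducible (varZ * basis N)" using reducible_monomial by metis
qed

lemma reducible: "reducible F"
proof (induction F)
  case (pCons a F)
  have "reducible [:a:]"
  proof (induction a)
    case (pCons p a)
    have "[:pCons p a:] = inX p * 1 + varY * [:a:]"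
      by (simp add: inX_def varY_def one_pCons[symmetric])
    moreover have "reducible (1 :: 'k poly3)" using reducible_monomial[of 0 0 0] by simp
    ultimately show ?case using pCons by (metis reducible_add reducible_inX reducible_varY)
  qed (simp add: reducible_0)
  moreover have "pCons a F = [:a:] + varZ * F" by (simp add: varZ_def)
  ultimately show ?case using pCons by (metis reducible_add reducible_varZ)
qed (rule reducible_0)

lemma lead_psi_basis: "lead (psi (basis N)) (int N) (- ord_bound n e d m (int N)) 1"
proof -
  define i j k where "i = N mod d" and "j = N div d mod m" and "k = N div (d * m)"
  have k: "k = N div d div m" by (simp add: k_def div_mult2_eq)
  have jk: "N div d = j + m * k" by (simp add: j_def k)
  have N: "N = i + d * (j + m * k)" unfolding jk[symmetric] i_def by simp
  have "lead (sT ^ i * yT ^ j * zT ^ k) (int i * 1 + int j * int d + int k * int (d * m))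
      (int i * 0 + int j * - int n + int k * - int (n * m + e)) ((1::'k) ^ i * 1 ^ j * 1 ^ k)"
    by (intro lead_mult lead_power lead_sT lead_yT lead_zT)
  moreover have "ord_bound n e d m (int N) = int n * int (N div d) + int e * int (N div (d * m))"
    by (simp add: ord_bound_def zdiv_int)
  moreover have "\<dots> = int n * int (j + m * k) + int e * int k" by (simp only: jk k_def)
  moreover have "int N = int i + int d * (int j + int m * int k)" by (subst N) simp
  ultimately show ?thesis
    by (simp add: basis_def psi_simps psi_polS psi_vars i_def[symmetric] j_def[symmetric] k_def[symmetric] algebra_simps)
qed

text \<open>
  The images of the basis elements have distinct \<open>s\<close>-degrees, so the last non-zero coefficient determines the leading term.
\<close>

lemma lead_normal_form:
  "(\<forall>N<K. c N = 0) \<or>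
   (\<exists>N J v. v \<noteq> 0 \<and> lead (psi (\<Sum>N<K. inX (c N) * basis N)) (int N) J v \<and> N < K \<and>
      J \<ge> - ord_bound n e d m (int N) \<and>
      (N = 0 \<longrightarrow> psi (\<Sum>N<K. inX (c N) * basis N) \<in> range emb))"
proof (induction K)
  case (Suc K)
  let ?s = "\<lambda>K. psi (\<Sum>N<K. inX (c N) * basis N)"
  have s: "?s (Suc K) = ?s K + emb (c K) * psi (basis K)" by (simp add: psi_simps psi_vars)
  show ?case
  proof (cases "c K = 0")
    case True
    then have "?s (Suc K) = ?s K" unfolding s by (simp add: emb_simps)
    from Suc show ?thesis
    proof
      assume "\<forall>N<K. c N = 0"
      then show ?thesis using True by (auto simp: less_Suc_eq)
    next
      assume "\<exists>N J v. v \<noteq> 0 \<and> lead (?s K) (int N) J v \<and> N < K \<and>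
        J \<ge> - ord_bound n e d m (int N) \<and> (N = 0 \<longrightarrow> ?s K \<in> range emb)"
      then show ?thesis unfolding \<open>?s (Suc K) = ?s K\<close> using less_SucI by blast
    qed
  next
    case False
    then obtain J v where J: "J \<ge> 0" "v \<noteq> 0" "lead (emb (c K)) 0 J v" by (rule emb_lead)
    from lead_mult[OF this(3) lead_psi_basis[of K]]
    have top: "lead (emb (c K) * psi (basis K)) (int K) (J - ord_bound n e d m (int K)) v" by simp
    have "lead (?s K) (int K) (J - ord_bound n e d m (int K)) 0"
      using Suc
    proof
      assume "\<forall>N<K. c N = 0"
      then have "?s K = 0" by (simp add: psi_simps psi_vars emb_simps)
      then show ?thesis by (simp add: lead_0)
    qed (auto intro: lead_weaken)
    from lead_add[OF this top] have "lead (?s (Suc K)) (int K) (J - ord_bound n e d m (int K)) v"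
      unfolding s by simp
    moreover have "?s (Suc K) \<in> range emb" if "K = 0"
      using that by (simp add: psi_simps psi_vars basis_def)
    ultimately show ?thesis using J by (intro disjI2 exI[of _ K] exI[of _ "J - ord_bound n e d m (int K)"] exI[of _ v]) auto
  qed
qed simp

lemma psi_normal_form:
  obtains K c where "rel_poly n e P Q dvd F - (\<Sum>N<K. inX (c N) * basis N)"
    "psi F = psi (\<Sum>N<K. inX (c N) * basis N)"
proof -
  obtain K c where *: "rel_poly n e P Q dvd F - (\<Sum>N<K. inX (c N) * basis N)"
    using reducible[of F] by (auto simp: reducible_def)
  then obtain G where "F - (\<Sum>N<K. inX (c N) * basis N) = rel_poly n e P Q * G" by (rule dvdE)
  then have "psi (F - (\<Sum>N<K. inX (c N) * basis N)) = 0" by (simp only: psi_simps(3) psi_rel mult_zero_left)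
  then have "psi F = psi (\<Sum>N<K. inX (c N) * basis N)" unfolding psi_simps(6) by simp
  then show ?thesis using that * by blast
qed

text \<open>
  A normal form in the kernel is zero, because its leading term cannot be cancelled.
\<close>

lemma psi_eq_0_iff: "psi F = 0 \<longleftrightarrow> rel_poly n e P Q dvd F"
proof
  assume 0: "psi F = 0"
  obtain K c where *: "rel_poly n e P Q dvd F - (\<Sum>N<K. inX (c N) * basis N)"
    "psi F = psi (\<Sum>N<K. inX (c N) * basis N)" by (rule psi_normal_form)
  have "\<forall>N<K. c N = 0" using lead_normal_form[of K c] 0 *(2) lead_nonzero by metis
  then show "rel_poly n e P Q dvd F" using *(1) by (simp add: ring_morphismD[OF ring_morphism_inX])
qed (auto simp: dvd_def psi_simps psi_rel)

lemma range_psi_lead: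
  assumes "F \<in> range psi" "lead F N J v" "v \<noteq> 0"
  shows "in_cone n e d m N J" "N = 0 \<Longrightarrow> F \<in> range emb"
proof -
  obtain G where "F = psi G" using assms by auto
  moreover obtain K c where "psi G = psi (\<Sum>N<K. inX (c N) * basis N)" by (rule psi_normal_form)
  ultimately have F: "F = psi (\<Sum>N<K. inX (c N) * basis N)" by simp
  have nz: "F \<noteq> 0" using lead_nonzero assms by blast
  have "F = 0" if "\<forall>N<K. c N = 0" using F that by (simp add: psi_simps psi_vars emb_simps)
  then have "\<not> (\<forall>N<K. c N = 0)" using nz by blast
  then obtain M L w where w: "w \<noteq> 0" "lead F (int M) L w" "L \<ge> - ord_bound n e d m (int M)"
      "M = 0 \<longrightarrow> F \<in> range emb"
    using lead_normal_form[of K c] F by metis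
  then have "N = int M" "J = L" using lead_unique[OF assms(2,3) w(2,1)] by auto
  then show "in_cone n e d m N J" "N = 0 \<Longrightarrow> F \<in> range emb" using w by (auto simp: in_cone_def)
qed

section \<open>Locally nilpotent derivations of the embedded ring\<close>

definition subalgebra :: "'k fls poly set \<Rightarrow> bool" where
  "subalgebra A \<longleftrightarrow> (\<forall>c. emb [:c:] \<in> A) \<and> xpow 1 \<in> A \<and>
     (\<forall>F\<in>A. \<forall>G\<in>A. F + G \<in> A) \<and> (\<forall>F\<in>A. \<forall>G\<in>A. F * G \<in> A)"

lemma subalgebra_emb: "subalgebra A \<Longrightarrow> emb p \<in> A"
proof (induction p)
  case 0
  then have "emb [:0:] \<in> A" unfolding subalgebra_def by blast
  then show ?case by simp
next
  case (pCons c p)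
  then have "emb [:c:] + xpow 1 * emb p \<in> A" by (simp add: subalgebra_def)
  then show ?case by (simp only: emb_pCons[of c p])
qed

lemma subalgebra_eval_poly:
  assumes "subalgebra A" "t \<in> A"
  shows "eval_poly emb t W \<in> A"
proof (induction W)
  case 0
  then show ?case using subalgebra_emb[OF assms(1), of 0] by (simp add: emb_simps)
next
  case (pCons c W)
  then show ?case using subalgebra_emb[OF assms(1), of c] assms
    by (auto simp: subalgebra_def eval_poly_pCons ring_morphism_emb)
qed

text \<open>
  An induction principle: the image of \<open>R\<close> is generated by \<open>k\<close>, \<open>x\<close>, \<open>y\<close> and \<open>z\<close>.
\<close>

lemma range_psi_subset:
  assumes A: "subalgebra A" and "yT \<in> A" "zT \<in> A"
  shows "range psi \<subseteq> A"
proof -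
  have "psi F \<in> A" for F
    unfolding psi_def
  proof (induction F)
    case 0
    then show ?case using subalgebra_emb[OF assms(1), of 0] by (simp add: emb_simps)
  next
    case (pCons a F)
    then show ?case using subalgebra_eval_poly[OF A assms(2)] assms
      by (auto simp: subalgebra_def eval_poly_pCons ring_morphism_eval_poly ring_morphism_emb)
  qed
  then show ?thesis by blast
qed

lemma range_psi_simps:
  "F \<in> range psi \<Longrightarrow> G \<in> range psi \<Longrightarrow> F + G \<in> range psi"
  "F \<in> range psi \<Longrightarrow> G \<in> range psi \<Longrightarrow> F * G \<in> range psi"
  "F \<in> range psi \<Longrightarrow> G \<in> range psi \<Longrightarrow> F - G \<in> range psi"
  "emb p \<in> range psi" "xpow 1 \<in> range psi" "xpow (int i) \<in> range psi"
  "yT \<in> range psi" "zT \<in> range psi" "sT \<in> range psi" "0 \<in> range psi"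
proof -
  have cl: "psi A + psi B \<in> range psi" "psi A * psi B \<in> range psi" "psi A - psi B \<in> range psi" for A B
    using rangeI[of psi "A + B"] rangeI[of psi "A * B"] rangeI[of psi "A - B"]
    by (simp_all add: psi_simps)
  show "F \<in> range psi \<Longrightarrow> G \<in> range psi \<Longrightarrow> F + G \<in> range psi"
    "F \<in> range psi \<Longrightarrow> G \<in> range psi \<Longrightarrow> F * G \<in> range psi"
    "F \<in> range psi \<Longrightarrow> G \<in> range psi \<Longrightarrow> F - G \<in> range psi"
    using cl by blast+
  show "emb p \<in> range psi" "xpow 1 \<in> range psi" "yT \<in> range psi" "zT \<in> range psi"
    unfolding psi_vars[symmetric] by simp_all
  show "xpow (int i) \<in> range psi" "sT \<in> range psi" "0 \<in> range psi"
    using rangeI[of psi "varX ^ i"] rangeI[of psi "polS e Q"] rangeI[of psi 0]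
    by (simp_all add: psi_simps psi_vars xpow_power psi_polS)
qed

lemma subalgebra_range_psi: "subalgebra (range psi)"
  unfolding subalgebra_def by (blast intro: range_psi_simps)

text \<open>
  Locally nilpotent \<open>k\<close>-derivations of the image of \<open>R\<close>, as functions on the ambient ring whose values elsewhere are
  arbitrary.
\<close>

definition lnd :: "('k fls poly \<Rightarrow> 'k fls poly) \<Rightarrow> bool" where
  "lnd D \<longleftrightarrow>
     (\<forall>F\<in>range psi. D F \<in> range psi) \<and>
     (\<forall>F\<in>range psi. \<forall>G\<in>range psi. D (F + G) = D F + D G) \<and>
     (\<forall>c. \<forall>F\<in>range psi. D (emb [:c:] * F) = emb [:c:] * D F) \<and>
     (\<forall>F\<in>range psi. \<forall>G\<in>range psi. D (F * G) = F * D G + D F * G) \<and>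
     (\<forall>F\<in>range psi. \<exists>i. (D ^^ i) F = 0)"

lemma lndD:
  assumes "lnd D" "F \<in> range psi"
  shows "D F \<in> range psi"
    "G \<in> range psi \<Longrightarrow> D (F + G) = D F + D G"
    "D (emb [:c:] * F) = emb [:c:] * D F"
    "G \<in> range psi \<Longrightarrow> D (F * G) = F * D G + D F * G"
    "\<exists>i. (D ^^ i) F = 0"
  using assms unfolding lnd_def by blast+

lemma yT_eq: "xpow (int n) * yT = eval_poly emb sT P"
  by (simp add: yT_def mult.assoc[symmetric] xpow_add xpow_0)

lemma zT_eq: "xpow (int e) * zT + sT = eval_poly emb yT Q"
  by (simp add: zT_def mult.assoc[symmetric] xpow_add xpow_0)

text \<open>
  Both sides are derivations that agree on \<open>k\<close>, \<open>x\<close> and \<open>s\<close>. They agree on \<open>y\<close> and \<open>z\<close> because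
  \<open>x\<^sup>n y\<close> and \<open>x\<^sup>e z\<close> are polynomials in elements already treated, and powers of \<open>x\<close> can be cancelled.
\<close>

lemma lnd_jacobian:
  assumes D: "lnd D" and F: "F \<in> range psi"
  shows "D F = x_deriv F * D (xpow 1) + pderiv F * D sT"
proof -
  define E where "E F = x_deriv F * D (xpow 1) + pderiv F * D sT" for F
  have E_add: "E (F + G) = E F + E G" for F G
    by (simp add: E_def x_deriv_add pderiv_add algebra_simps)
  have E_mult: "E (F * G) = F * E G + E F * G" for F G
    by (simp add: E_def x_deriv_mult pderiv_mult algebra_simps)
  define A where "A = {F \<in> range psi. D F = E F}"
  have "subalgebra A" unfolding subalgebra_def
  proof (intro conjI allI ballI)
    fix c
    have 1: "1 \<in> range psi" using range_psi_simps(4)[of 1] by (simp add: emb_simps)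
    have "D (1 * 1) = 1 * D 1 + D 1 * 1" by (rule lndD(4)[OF D 1 1])
    then have "D 1 = 0" by simp
    then have "D (emb [:c:]) = 0" using lndD(3)[OF D 1, of c] by simp
    then show "emb [:c:] \<in> A"
      by (simp add: A_def range_psi_simps E_def x_deriv_emb_const pderiv_emb)
    show "xpow 1 \<in> A" by (simp add: A_def range_psi_simps E_def partial_derivatives_vars)
    fix F G assume "F \<in> A" "G \<in> A"
    then show "F + G \<in> A" "F * G \<in> A"
      by (auto simp only: A_def mem_Collect_eq range_psi_simps E_add E_mult lndD[OF D])
  qed
  have cancel: "G \<in> A" if "xpow (int i) * G \<in> A" "G \<in> range psi" for i G
  proof -
    have "xpow (int i) \<in> A"
      using subalgebra_emb[OF \<open>subalgebra A\<close>, of "[:0, 1:] ^ i"] by (simp add: emb_simps emb_X_power)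
    then have X: "xpow (int i) \<in> range psi" "D (xpow (int i)) = E (xpow (int i))"
      by (auto simp: A_def)
    have "D (xpow (int i) * G) = E (xpow (int i) * G)" using that by (simp add: A_def)
    then have "xpow (int i) * D G = xpow (int i) * E G"
      unfolding lndD(4)[OF D X(1) that(2)] E_mult X(2) by simp
    then show ?thesis using that by (simp add: A_def xpow_nonzero)
  qed
  have s: "sT \<in> A" by (simp add: A_def range_psi_simps E_def partial_derivatives_vars)
  have y: "yT \<in> A"
    by (rule cancel[of n]) (simp_all only: yT_eq subalgebra_eval_poly[OF \<open>subalgebra A\<close> s] range_psi_simps)
  have "xpow (int e) * zT = eval_poly emb yT Q + emb [:- 1:] * sT"
    unfolding zT_eq[symmetric] by (simp add: emb_const one_pCons[symmetric])
  also have "\<dots> \<in> A"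
    using subalgebra_eval_poly[OF \<open>subalgebra A\<close> y] s \<open>subalgebra A\<close> unfolding subalgebra_def by blast
  finally have z: "zT \<in> A" by (rule cancel) (rule range_psi_simps)
  have "F \<in> A" using range_psi_subset[OF \<open>subalgebra A\<close> y z] F by blast
  then show ?thesis by (simp add: A_def E_def)
qed

text \<open>
  The pair \<open>(b, a)\<close> is the larger of the two shifts \<open>x \<mapsto> D(x)\<close> and \<open>s \<mapsto> D(s)\<close> of leading exponents.
\<close>

lemma lnd_leading_part:
  assumes nz: "\<not> (D (xpow 1) = 0 \<and> D sT = 0)"
  obtains a b \<alpha> \<beta> where "lead (D (xpow 1)) b (a + 1) \<alpha>" "lead (D sT) (b + 1) a \<beta>" "\<alpha> \<noteq> 0 \<or> \<beta> \<noteq> (0 :: 'k)"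
proof (cases "D (xpow 1) = 0")
  case True
  then obtain N J u where "lead (D sT) N J u" "u \<noteq> 0" using nz lead_exists by blast
  then show ?thesis using that[of "N - 1" J 0 u] True by (simp add: lead_0)
next
  case False
  then obtain N J u where x: "lead (D (xpow 1)) N J u" "u \<noteq> 0" using lead_exists by blast
  show ?thesis
  proof (cases "D sT = 0")
    case True
    then show ?thesis using that[of N "J - 1" u 0] x by (simp add: lead_0)
  next
    case False
    then obtain M L v where s: "lead (D sT) M L v" "v \<noteq> 0" using lead_exists by blast
    consider "M < N + 1 \<or> M = N + 1 \<and> J - 1 < L" | "N < M - 1 \<or> N = M - 1 \<and> L + 1 < J" | "M = N + 1" "J - 1 = L"
      by linarith
    then show ?thesis
    proof cases
      case 1
      then show ?thesis using that[of N "J - 1" u 0] x lead_weaken[OF s(1)] by simp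
    next
      case 2
      then show ?thesis using that[of "M - 1" L 0 v] s lead_weaken[OF x(1)] by simp
    next
      case 3
      then show ?thesis using that[of N L u v] x s by auto
    qed
  qed
qed

lemma lead_lnd:
  assumes "lnd D" "F \<in> range psi" "lead F N J u"
    and "lead (D (xpow 1)) b (a + 1) \<alpha>" "lead (D sT) (b + 1) a \<beta>"
  shows "lead (D F) (N + b) (J + a) ((\<alpha> * of_int J + \<beta> * of_int N) * u)"
proof -
  have "lead (x_deriv F * D (xpow 1) + pderiv F * D sT) (N + b) (J + a) (of_int J * u * \<alpha> + of_int N * u * \<beta>)"
    using lead_mult[OF lead_x_deriv[OF assms(3)] assms(4)] lead_mult[OF lead_pderiv[OF assms(3)] assms(5)]
    by (intro lead_add) (simp_all add: algebra_simps)
  then show ?thesis by (simp add: lnd_jacobian[OF assms(1,2)] algebra_simps)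
qed

text \<open>
  As long as the scalar factor of the leading term does not vanish, applying \<open>D\<close> moves the leading exponent by \<open>(b, a)\<close>.
  Local nilpotency says that this stops, and until then the exponents belong to elements of \<open>R\<close>.
\<close>

lemma lnd_chain:
  assumes D: "lnd D" and F: "F \<in> range psi" "lead F N J 1"
    and "lead (D (xpow 1)) b (a + 1) \<alpha>" "lead (D sT) (b + 1) a \<beta>"
  shows "\<exists>t::nat. (\<alpha> * of_int J + \<beta> * of_int N) + of_nat t * (\<alpha> * of_int a + \<beta> * of_int b) = 0 \<and>
    (\<forall>t'\<le>t. in_cone n e d m (N + int t' * b) (J + int t' * a))"
proof -
  define w where "w t = (\<alpha> * of_int J + \<beta> * of_int N) + of_nat t * (\<alpha> * of_int a + \<beta> * of_int b)" for t :: nat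
  have w: "w t = \<alpha> * of_int (J + int t * a) + \<beta> * of_int (N + int t * b)" for t
    by (simp add: w_def algebra_simps)
  have mem: "(D ^^ t) F \<in> range psi" for t
  proof (induction t)
    case 0
    show ?case using F(1) by simp
  next
    case (Suc t)
    show ?case using lndD(1)[OF D Suc] by simp
  qed
  have step: "\<exists>v. v \<noteq> 0 \<and> lead ((D ^^ t) F) (N + int t * b) (J + int t * a) v" if "\<forall>t'<t. w t' \<noteq> 0" for t
    using that
  proof (induction t)
    case 0
    show ?case by (rule exI[of _ 1]) (simp add: F(2))
  next
    case (Suc t)
    have "\<forall>t'<t. w t' \<noteq> 0" using Suc.prems by simp
    then obtain v where v: "v \<noteq> 0" "lead ((D ^^ t) F) (N + int t * b) (J + int t * a) v"
      using Suc.IH by blast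
    from lead_lnd[OF D mem v(2) assms(4,5)]
    have "lead ((D ^^ Suc t) F) (N + int (Suc t) * b) (J + int (Suc t) * a) (w t * v)"
      by (simp add: w algebra_simps)
    moreover have "w t * v \<noteq> 0" using Suc.prems v by simp
    ultimately show ?case by blast
  qed
  have "\<exists>t. w t = 0"
  proof (rule ccontr)
    assume "\<nexists>t. w t = 0"
    moreover obtain i where i: "(D ^^ i) F = 0" using lndD(5)[OF D F(1)] ..
    ultimately obtain v where "v \<noteq> 0" "lead ((D ^^ i) F) (N + int i * b) (J + int i * a) v"
      using step[of i] by auto
    then show False using i lead_nonzero by blast
  qed
  define t where "t = (LEAST t. w t = 0)"
  have t: "w t = 0" unfolding t_def by (rule LeastI_ex) fact
  have "in_cone n e d m (N + int t' * b) (J + int t' * a)" if "t' \<le> t" for t'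
  proof -
    have "w t'' \<noteq> 0" if "t'' < t'" for t''
      using not_less_Least[of t'' "\<lambda>t. w t = 0"] that \<open>t' \<le> t\<close> unfolding t_def by linarith
    then obtain v where "v \<noteq> 0" "lead ((D ^^ t') F) (N + int t' * b) (J + int t' * a) v"
      using step by blast
    then show ?thesis using range_psi_lead(1)[OF mem] by blast
  qed
  with t show ?thesis unfolding w_def by blast
qed

lemma lnd_kills_x:
  assumes D: "lnd D"
  shows "D (xpow 1) = 0 \<and> D sT \<in> range emb"
proof (cases "D (xpow 1) = 0 \<and> D sT = 0")
  case True
  then show ?thesis using emb_simps(4) by (metis rangeI)
next
  case False
  obtain a b \<alpha> \<beta> where L: "lead (D (xpow 1)) b (a + 1) \<alpha>" "lead (D sT) (b + 1) a \<beta>" "\<alpha> \<noteq> 0 \<or> \<beta> \<noteq> 0"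
    using lnd_leading_part[OF False] by metis
  define \<mu> where "\<mu> = \<alpha> * of_int a + \<beta> * of_int b"
  note chain = lnd_chain[OF D _ _ L(1,2), folded \<mu>_def]
  obtain tx where tx: "\<alpha> + of_nat tx * \<mu> = 0"
    "\<And>t. t \<le> tx \<Longrightarrow> in_cone n e d m (int t * b) (1 + int t * a)"
    using chain[OF range_psi_simps(5) lead_xpow] by auto
  obtain ts where ts: "\<beta> + of_nat ts * \<mu> = 0"
    "\<And>t. t \<le> ts \<Longrightarrow> in_cone n e d m (1 + int t * b) (int t * a)"
    using chain[OF range_psi_simps(9) lead_sT] by auto
  obtain ty where ty: "- \<alpha> * of_nat n + \<beta> * of_nat d + of_nat ty * \<mu> = 0"
    "\<And>t. t \<le> ty \<Longrightarrow> in_cone n e d m (int d + int t * b) (- int n + int t * a)"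
    using chain[OF range_psi_simps(7) lead_yT] by auto
  obtain tz where tz: "- \<alpha> * of_nat (n * m + e) + \<beta> * of_nat (d * m) + of_nat tz * \<mu> = 0"
    using chain[OF range_psi_simps(8) lead_zT] by (auto simp: algebra_simps)
  have \<alpha>: "\<alpha> = - (of_nat tx * \<mu>)" and \<beta>: "\<beta> = - (of_nat ts * \<mu>)"
    using tx(1) ts(1) by (simp_all add: eq_neg_iff_add_eq_0)
  have \<mu>: "\<mu> \<noteq> 0" using L(3) \<alpha> \<beta> by auto
  \<comment> \<open>Scalars in \<open>k\<close> become integers: \<open>\<alpha>\<close> and \<open>\<beta>\<close> are multiples of the value \<open>\<mu>\<close> on the step, and \<open>k\<close> has
          characteristic zero.\<close>
  have "\<mu> = \<alpha> * of_int a + \<beta> * of_int b" by (rule \<mu>_def)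
  also have "\<dots> = - (of_nat tx * \<mu>) * of_int a + - (of_nat ts * \<mu>) * of_int b"
    by (simp only: \<alpha>[symmetric] \<beta>[symmetric])
  finally have "\<mu> - (- (of_nat tx * \<mu>) * of_int a + - (of_nat ts * \<mu>) * of_int b) = 0"
    by (simp only: right_minus_eq)
  then have "of_int (int tx * a + int ts * b + 1) * \<mu> = 0"
    by (simp add: algebra_simps)
  then have root: "int tx * a + int ts * b = -1"
    using \<mu> by (simp only: mult_eq_0_iff of_int_eq_0_iff) simp
  have "of_int (int n * int tx - int d * int ts + int ty) * \<mu> = 0"
    using ty(1) by (simp add: \<alpha> \<beta> algebra_simps)
  then have ty': "int ty = int d * int ts - int n * int tx"
    using \<mu> by (simp only: mult_eq_0_iff of_int_eq_0_iff) simp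
  have "of_int ((int n * int m + int e) * int tx - int d * int m * int ts + int tz) * \<mu> = 0"
    using tz(1) by (simp add: \<alpha> \<beta> algebra_simps)
  then have tz': "int d * int m * int ts - (int n * int m + int e) * int tx \<ge> 0"
    using \<mu> by (simp only: mult_eq_0_iff of_int_eq_0_iff) simp
  have "tx = 0"
    using weight_of_x_zero[OF n ne d m root ty' tz' tx(2) ts(2) ty(2)] by blast
  then have "\<alpha> = 0" and "int ts * b = -1" using \<alpha> root by simp_all
  then have "int ts * (- b) = 1" by simp
  then have "int ts = 1 \<and> - b = 1 \<or> int ts = - 1 \<and> - b = - 1" by (simp only: zmult_eq_1_iff)
  then have "b = -1" by auto
  then have "D (xpow 1) = 0" using lead_negative[OF L(1)] by simp
  moreover have "D sT \<in> range emb"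
    using range_psi_lead(2)[OF lndD(1)[OF D range_psi_simps(9)] L(2)] L(3) \<open>\<alpha> = 0\<close> \<open>b = -1\<close> by simp
  ultimately show ?thesis by blast
qed

section \<open>The derivation $\<partial>$ generates all others\<close>

text \<open>
  The derivation \<open>\<partial>\<close> in the coordinates \<open>x\<close>, \<open>s\<close>.
\<close>

definition del :: "'k fls poly \<Rightarrow> 'k fls poly" where
  "del F = xpow (int (n + e)) * pderiv F"

text \<open>
  The bound on leading exponents is applied to \<open>D(z) = D(s) \<cdot> dz/ds\<close>: the derivative \<open>dz/ds\<close> has a pole of order
  \<open>nm + e\<close> in degree \<open>dm - 1\<close>, where elements of \<open>R\<close> have poles of order at most \<open>n(m - 1)\<close>.
\<close>

lemma lnd_multiple_of_del:
  assumes D: "lnd D"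
  obtains h where "\<And>F. F \<in> range psi \<Longrightarrow> D F = emb h * del F"
proof -
  obtain h where h: "D (xpow 1) = 0" "D sT = emb h" using lnd_kills_x[OF D] by blast
  have DF: "D F = pderiv F * emb h" if "F \<in> range psi" for F
    using lnd_jacobian[OF D that] h by simp
  have "coeff h i = 0" if "i < n + e" for i
  proof (cases "h = 0")
    case False
    then obtain J v where J: "v \<noteq> 0" "lead (emb h) 0 J v" by (rule emb_lead)
    have "lead (D zT) (int (d * m) - 1) (- int (n * m + e) + J) (of_int (int (d * m)) * 1 * v)"
      unfolding DF[OF range_psi_simps(8)]
      using lead_mult[OF lead_pderiv[OF lead_zT] J(2)] by simp
    moreover have "of_int (int (d * m)) * 1 * v \<noteq> 0" using J d m by simp
    ultimately have "in_cone n e d m (int (d * m) - 1) (- int (n * m + e) + J)"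
      by (rule range_psi_lead(1)[OF lndD(1)[OF D range_psi_simps(8)]])
    moreover have "ord_bound n e d m (int (d * m) - 1) = int n * (int m - 1)"
    proof -
      have "(int (d * m) - 1) div int d = int m - 1"
        using d by (intro int_div_pos_eq[of _ _ _ "int d - 1"]) (auto simp: algebra_simps)
      moreover have "(int (d * m) - 1) div (int d * int m) = 0"
        using d m by (intro div_pos_pos_trivial) auto
      ultimately show ?thesis by (simp only: ord_bound_def)
    qed
    ultimately have "J \<ge> int (n + e)" by (simp add: in_cone_def algebra_simps)
    then have "s_coeff (emb h) 0 $$ int i = 0" using leadD(2)[OF J(2)] that by simp
    then show ?thesis by (simp add: s_coeff_def emb_def)
  qed simp
  then have "monom 1 (n + e) dvd h" by (simp add: monom_1_dvd_iff')
  then obtain h' where "h = [:0, 1:] ^ (n + e) * h'" by (auto simp: dvd_def monom_altdef)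
  then have "emb h = xpow (int (n + e)) * emb h'" by (simp only: emb_simps emb_X_power)
  then show ?thesis using that[of h'] DF by (simp add: del_def algebra_simps)
qed

lemma del_simps:
  "del (F + G) = del F + del G" "del (F * G) = F * del G + del F * G" "del (emb p) = 0" "del 0 = 0"
  "del (emb p * F) = emb p * del F"
  by (simp_all add: del_def pderiv_add pderiv_mult pderiv_emb algebra_simps)

lemma del_vars:
  "del (xpow 1) = 0" "del sT = xpow (int (n + e))"
  "del yT = xpow (int e) * eval_poly emb sT (pderiv P)"
  "del zT = eval_poly emb yT (pderiv Q) * eval_poly emb sT (pderiv P) - xpow (int n)"
proof -
  show "del (xpow 1) = 0" "del sT = xpow (int (n + e))" by (simp_all add: del_def partial_derivatives_vars)
  have y: "pderiv yT = xpow (- int n) * eval_poly emb sT (pderiv P)"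
    by (simp add: yT_def pderiv_mult partial_derivatives_vars pderiv_eval_poly)
  have z: "pderiv zT = xpow (- int e) * (eval_poly emb yT (pderiv Q) * pderiv yT - 1)"
    by (simp add: zT_def pderiv_mult partial_derivatives_vars pderiv_eval_poly pderiv_diff)
  have n: "xpow (int (n + e)) * xpow (- int e) = (xpow (int n) :: 'k fls poly)"
    by (simp add: xpow_add)
  have e: "xpow (int (n + e)) * xpow (- int n) = (xpow (int e) :: 'k fls poly)"
    by (simp add: xpow_add)
  have o: "xpow (int n) * xpow (- int n) = (1 :: 'k fls poly)"
    by (simp add: xpow_add xpow_0)
  show "del yT = xpow (int e) * eval_poly emb sT (pderiv P)"
    unfolding del_def y mult.assoc[symmetric] e ..
  have "del zT = xpow (int n) * (eval_poly emb yT (pderiv Q) * pderiv yT - 1)"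
    unfolding del_def z mult.assoc[symmetric] n ..
  also have "\<dots> = eval_poly emb yT (pderiv Q) * ((xpow (int n) * xpow (- int n)) * eval_poly emb sT (pderiv P)) - xpow (int n)"
    by (simp add: y algebra_simps)
  finally show "del zT = eval_poly emb yT (pderiv Q) * eval_poly emb sT (pderiv P) - xpow (int n)"
    by (simp add: o)
qed

lemma del_mem: 
  assumes F: "F \<in> range psi"
  shows "del F \<in> range psi"
proof -
  let ?A = "{F \<in> range psi. del F \<in> range psi}"
  have "subalgebra ?A"
    unfolding subalgebra_def
    by (intro conjI allI ballI) (simp_all add: range_psi_simps del_simps del_vars)
  moreover have "yT \<in> ?A" "zT \<in> ?A"
    by (simp_all add: range_psi_simps del_vars subalgebra_eval_poly[OF subalgebra_range_psi])
  ultimately show ?thesis using range_psi_subset F by blast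
qed

lemma del_eq_0:
  assumes "F \<in> range psi" "del F = 0"
  shows "F \<in> range emb"
proof (cases "F = 0")
  case True
  then show ?thesis using emb_simps(4) by (metis rangeI)
next
  case False
  then obtain N J u where l: "lead F N J u" "u \<noteq> 0" by (rule lead_exists)
  have "pderiv F = 0" using assms(2) by (simp add: del_def xpow_nonzero)
  then have "N = 0" using lead_pderiv[OF l(1)] l(2) lead_nonzero by fastforce
  then show ?thesis using range_psi_lead(2)[OF assms(1) l] by blast
qed

lemma funpow_scaled_del: "((\<lambda>F. emb h * del F) ^^ i) F = emb h ^ i * (del ^^ i) F"
proof (induction i)
  case (Suc i)
  have "del (emb h ^ i * (del ^^ i) F) = emb h ^ i * del ((del ^^ i) F)"
    using del_simps(5)[of "h ^ i"] by (simp add: emb_simps)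
  then show ?case by (simp add: Suc)
qed simp

lemma del_nilpotent: "\<exists>i. (del ^^ i) F = 0"
proof -
  have "(del ^^ i) F = xpow (int (n + e)) ^ i * (pderiv ^^ i) F" for i
  proof (induction i)
    case (Suc i)
    have "del (xpow (int (n + e)) ^ i * (pderiv ^^ i) F) = xpow (int (n + e)) ^ i * del ((pderiv ^^ i) F)"
      using del_simps(5)[of "([:0, 1:] ^ (n + e)) ^ i"] by (simp add: emb_simps emb_X_power)
    then show ?case by (simp add: Suc) (simp add: del_def)
  qed simp
  then show ?thesis using funpow_pderiv_degree[of F "Suc (degree F)"] by (metis mult_zero_right lessI)
qed

lemma lnd_scaled_del: "lnd (\<lambda>F. emb h * del F)"
  unfolding lnd_def
proof (intro conjI ballI allI)
  fix F G c assume F: "F \<in> range psi"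
  show "emb h * del F \<in> range psi" using F by (intro range_psi_simps del_mem)
  show "\<exists>i. ((\<lambda>F. emb h * del F) ^^ i) F = 0"
    using del_nilpotent[of F] by (auto simp: funpow_scaled_del)
qed (simp_all add: del_simps algebra_simps)

section \<open>The quotient ring\<close>

abbreviation "R \<equiv> R_ring n e P Q"
abbreviation "K \<equiv> R_base n e P Q"

text \<open>
  The coset in \<open>R\<close> that corresponds to \<open>F\<close>.
\<close>

definition fiber :: "'k fls poly \<Rightarrow> 'k poly3 set" where
  "fiber F = psi -` {F}"

text \<open>
  The inverse of \<open>fiber\<close> on the carrier of \<open>R\<close>.
\<close>

definition value_of :: "'k poly3 set \<Rightarrow> 'k fls poly" where
  "value_of C = psi (SOME A. A \<in> C)"

lemma value_of_fiber [simp]: "F \<in> range psi \<Longrightarrow> value_of (fiber F) = F"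
proof -
  assume "F \<in> range psi"
  then have "\<exists>A. A \<in> fiber F" by (auto simp: fiber_def)
  then have "(SOME A. A \<in> fiber F) \<in> fiber F" by (rule someI_ex)
  then show ?thesis by (simp add: value_of_def fiber_def)
qed

lemma fiber_eq_iff: "F \<in> range psi \<Longrightarrow> G \<in> range psi \<Longrightarrow> fiber F = fiber G \<longleftrightarrow> F = G"
  using value_of_fiber by metis

lemma ideal_R_ideal: "ideal (R_ideal n e P Q) kXYZ"
  unfolding R_ideal_def by (intro ring.genideal_ideal ring_from_type_algebra) (simp add: ring_of_type_algebra_def)

lemma R_ideal_iff: "A \<in> R_ideal n e P Q \<longleftrightarrow> psi A = 0"
proof -
  have "R_ideal n e P Q = PIdl\<^bsub>kXYZ\<^esub> (rel_poly n e P Q)"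
    unfolding R_ideal_def
    by (rule cring.cgenideal_eq_genideal[OF cring_from_type_algebra, symmetric]) (simp add: ring_of_type_algebra_def)
  then show ?thesis
    by (auto simp: psi_eq_0_iff cgenideal_def ring_of_type_algebra_def dvd_def mult.commute)
qed

lemma R_class_fiber: "R_class n e P Q A = fiber (psi A)"
proof -
  have "R_class n e P Q A = {B + A | B. psi B = 0}"
    by (auto simp: R_class_def a_r_coset_def' R_ideal_iff ring_of_type_algebra_def)
  also have "\<dots> = fiber (psi A)"
  proof (intro subset_antisym subsetI)
    fix C assume "C \<in> fiber (psi A)"
    then have "C = (C - A) + A" "psi (C - A) = 0" by (simp_all add: fiber_def psi_simps)
    then show "C \<in> {B + A | B. psi B = 0}" by blast
  qed (auto simp: fiber_def psi_simps)
  finally show ?thesis .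
qed

lemma carrier_R: "carrier R = fiber ` range psi"
proof -
  have "carrier R = range (R_class n e P Q)"
    by (auto simp: R_ring_def FactRing_def A_RCOSETS_def' R_class_def ring_of_type_algebra_def)
  then show ?thesis by (simp add: R_class_fiber image_image)
qed

lemma carrier_RE:
  assumes "b \<in> carrier R"
  obtains F where "F \<in> range psi" "b = fiber F"
  using assms unfolding carrier_R by (rule imageE)

lemma R_operations:
  assumes "F \<in> range psi" "G \<in> range psi"
  shows "fiber F \<oplus>\<^bsub>R\<^esub> fiber G = fiber (F + G)" "fiber F \<otimes>\<^bsub>R\<^esub> fiber G = fiber (F * G)"
proof -
  have hom: "R_class n e P Q \<in> ring_hom kXYZ R"
    using ideal.rcos_ring_hom[OF ideal_R_ideal] unfolding R_class_def[abs_def] R_ring_def .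
  obtain A B where "F = psi A" "G = psi B" using assms by blast
  then show "fiber F \<oplus>\<^bsub>R\<^esub> fiber G = fiber (F + G)" "fiber F \<otimes>\<^bsub>R\<^esub> fiber G = fiber (F * G)"
    using ring_hom_add[OF hom, of A B] ring_hom_mult[OF hom, of A B]
    by (simp_all add: R_class_fiber psi_simps ring_of_type_algebra_def)
qed

lemma zero_R: "\<zero>\<^bsub>R\<^esub> = fiber 0"
  by (auto simp: R_ring_def FactRing_def R_ideal_iff fiber_def)

lemma base_R: "K = range (\<lambda>c. fiber (emb [:c:]))"
  by (simp add: R_base_def R_class_fiber psi_vars)

lemma at_x_R: "R_at_x n e P Q h = fiber (emb h)"
  by (simp add: R_at_x_def R_class_fiber psi_vars)

lemma kx_R: "R_kx n e P Q = fiber ` range emb"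
  by (auto simp: R_kx_def at_x_R)

definition transport :: "('k fls poly \<Rightarrow> 'k fls poly) \<Rightarrow> 'k poly3 set \<Rightarrow> 'k poly3 set" where
  "transport \<Delta> = (\<lambda>b\<in>carrier R. fiber (\<Delta> (value_of b)))"

lemma fiber_carrier: "F \<in> range psi \<Longrightarrow> fiber F \<in> carrier R"
  by (simp add: carrier_R)

lemma transport_fiber: "F \<in> range psi \<Longrightarrow> transport \<Delta> (fiber F) = fiber (\<Delta> F)"
  by (simp add: transport_def fiber_carrier)

lemma transport_funpow:
  assumes "\<And>F. F \<in> range psi \<Longrightarrow> \<Delta> F \<in> range psi" "F \<in> range psi"
  shows "(transport \<Delta> ^^ i) (fiber F) = fiber ((\<Delta> ^^ i) F) \<and> (\<Delta> ^^ i) F \<in> range psi"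
  by (induction i) (simp_all add: assms transport_fiber)

lemma transport_LND:
  assumes D: "lnd \<Delta>"
  shows "transport \<Delta> \<in> LND R K"
proof -
  have "transport \<Delta> \<in> carrier R \<rightarrow>\<^sub>E carrier R"
  proof (rule PiE_I)
    fix b assume "b \<in> carrier R"
    then obtain F where "F \<in> range psi" "b = fiber F" by (rule carrier_RE)
    then show "transport \<Delta> b \<in> carrier R" by (simp only: transport_fiber fiber_carrier lndD(1)[OF D])
  qed (simp add: transport_def)
  moreover have "\<exists>i. (transport \<Delta> ^^ i) b = \<zero>\<^bsub>R\<^esub>" if "b \<in> carrier R" for b
  proof -
    obtain F where F: "F \<in> range psi" "b = fiber F" using \<open>b \<in> carrier R\<close> by (rule carrier_RE)
    obtain i where "(\<Delta> ^^ i) F = 0" using lndD(5)[OF D F(1)] ..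
    then show ?thesis using transport_funpow[of \<Delta> F i, OF lndD(1)[OF D] F(1)]
      by (intro exI[where x = i]) (simp only: zero_R F(2))
  qed
  ultimately show ?thesis
    unfolding LND_def derivations_def base_R
  proof (intro CollectI conjI ballI)
    fix a b assume "a \<in> carrier R" "b \<in> carrier R"
    obtain F where F: "F \<in> range psi" "a = fiber F"
      using \<open>a \<in> carrier R\<close> by (rule carrier_RE)
    obtain G where G: "G \<in> range psi" "b = fiber G"
      using \<open>b \<in> carrier R\<close> by (rule carrier_RE)
    note simps = R_operations transport_fiber lndD[OF D] range_psi_simps F(1) G(1)
    show "transport \<Delta> (a \<oplus>\<^bsub>R\<^esub> b) = transport \<Delta> a \<oplus>\<^bsub>R\<^esub> transport \<Delta> b"
      unfolding F(2) G(2) by (simp only: simps)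
    show "transport \<Delta> (a \<otimes>\<^bsub>R\<^esub> b) = (a \<otimes>\<^bsub>R\<^esub> transport \<Delta> b) \<oplus>\<^bsub>R\<^esub> (transport \<Delta> a \<otimes>\<^bsub>R\<^esub> b)"
      unfolding F(2) G(2) by (simp only: simps)
  next
    fix c a assume "c \<in> range (\<lambda>c. fiber (emb [:c:]))" "a \<in> carrier R"
    then obtain c' where c: "c = fiber (emb [:c':])" by blast
    obtain F where F: "F \<in> range psi" "a = fiber F"
      using \<open>a \<in> carrier R\<close> by (rule carrier_RE)
    note simps = R_operations transport_fiber lndD(1,3)[OF D] range_psi_simps F(1)
    show "transport \<Delta> (c \<otimes>\<^bsub>R\<^esub> a) = c \<otimes>\<^bsub>R\<^esub> transport \<Delta> a"
      unfolding F(2) c by (simp only: simps)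
  qed
qed

lemma LND_transport:
  assumes "D \<in> LND R K"
  obtains \<Delta> where "lnd \<Delta>" "D = transport \<Delta>"
proof -
  have D: "D \<in> carrier R \<rightarrow>\<^sub>E carrier R"
    "\<And>a b. a \<in> carrier R \<Longrightarrow> b \<in> carrier R \<Longrightarrow> D (a \<oplus>\<^bsub>R\<^esub> b) = D a \<oplus>\<^bsub>R\<^esub> D b"
    "\<And>c a. a \<in> carrier R \<Longrightarrow> D (fiber (emb [:c:]) \<otimes>\<^bsub>R\<^esub> a) = fiber (emb [:c:]) \<otimes>\<^bsub>R\<^esub> D a"
    "\<And>a b. a \<in> carrier R \<Longrightarrow> b \<in> carrier R \<Longrightarrow> D (a \<otimes>\<^bsub>R\<^esub> b) = (a \<otimes>\<^bsub>R\<^esub> D b) \<oplus>\<^bsub>R\<^esub> (D a \<otimes>\<^bsub>R\<^esub> b)"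
    "\<And>b. b \<in> carrier R \<Longrightarrow> \<exists>i. (D ^^ i) b = \<zero>\<^bsub>R\<^esub>"
    using assms unfolding LND_def derivations_def base_R by blast+
  define \<Delta> where "\<Delta> F = value_of (D (fiber F))" for F
  have \<Delta>: "\<Delta> F \<in> range psi \<and> D (fiber F) = fiber (\<Delta> F)" if F: "F \<in> range psi" for F
  proof -
    have "D (fiber F) \<in> carrier R" using D(1) fiber_carrier[OF F] by blast
    then obtain G where "G \<in> range psi" "D (fiber F) = fiber G" by (rule carrier_RE)
    then show ?thesis by (simp add: \<Delta>_def)
  qed
  have \<Delta>1: "\<Delta> F \<in> range psi" and \<Delta>2: "D (fiber F) = fiber (\<Delta> F)" if "F \<in> range psi" for F
    using \<Delta>[OF that] by blast+
  have "D = transport \<Delta>"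
  proof (rule extensionalityI[of _ "carrier R"])
    fix b assume "b \<in> carrier R"
    then obtain F where "F \<in> range psi" "b = fiber F" by (rule carrier_RE)
    then show "D b = transport \<Delta> b" by (simp only: \<Delta>2 transport_fiber)
  qed (use D(1) in \<open>auto simp: transport_def PiE_def\<close>)
  moreover have "lnd \<Delta>"
    unfolding lnd_def
  proof (intro conjI ballI allI)
    fix F assume F: "F \<in> range psi"
    show "\<Delta> F \<in> range psi" by (rule \<Delta>1[OF F])
    obtain i where "(D ^^ i) (fiber F) = \<zero>\<^bsub>R\<^esub>" using D(5)[OF fiber_carrier[OF F]] ..
    then have "(transport \<Delta> ^^ i) (fiber F) = fiber 0" by (simp only: \<open>D = transport \<Delta>\<close> zero_R)
    then have "fiber ((\<Delta> ^^ i) F) = fiber 0" and "(\<Delta> ^^ i) F \<in> range psi"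
      using transport_funpow[of \<Delta> F i, OF \<Delta>1 F] by (simp_all only:)
    then show "\<exists>i. (\<Delta> ^^ i) F = 0"
      using fiber_eq_iff[OF _ range_psi_simps(10)] by blast
    show "\<Delta> (emb [:c:] * F) = emb [:c:] * \<Delta> F" for c
      using D(3)[OF fiber_carrier[OF F], of c]
      by (simp only: R_operations \<Delta>1 \<Delta>2 range_psi_simps fiber_eq_iff F)
    fix G assume G: "G \<in> range psi"
    show "\<Delta> (F + G) = \<Delta> F + \<Delta> G"
      using D(2)[OF fiber_carrier[OF F] fiber_carrier[OF G]]
      by (simp only: R_operations \<Delta>1 \<Delta>2 range_psi_simps fiber_eq_iff F G)
    show "\<Delta> (F * G) = F * \<Delta> G + \<Delta> F * G"
      using D(4)[OF fiber_carrier[OF F] fiber_carrier[OF G]]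
      by (simp only: R_operations \<Delta>1 \<Delta>2 range_psi_simps fiber_eq_iff F G)
  qed
  ultimately show ?thesis using that by blast
qed

definition multiple_der :: "'k poly \<Rightarrow> 'k poly3 set \<Rightarrow> 'k poly3 set" where
  "multiple_der h = transport (\<lambda>F. emb h * del F)"

lemma multiple_der_fiber: "F \<in> range psi \<Longrightarrow> multiple_der h (fiber F) = fiber (emb h * del F)"
  by (simp add: multiple_der_def transport_fiber)

lemma LND_R: "LND R K = range multiple_der"
proof
  show "LND R K \<subseteq> range multiple_der"
  proof
    fix D assume "D \<in> LND R K"
    then obtain \<Delta> where \<Delta>: "lnd \<Delta>" "D = transport \<Delta>" by (rule LND_transport)
    obtain h where h: "\<And>F. F \<in> range psi \<Longrightarrow> \<Delta> F = emb h * del F"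
      using lnd_multiple_of_del[OF \<Delta>(1)] by blast
    have "D = multiple_der h"
      unfolding \<Delta>(2) multiple_der_def transport_def
    proof (rule restrict_ext)
      fix b assume "b \<in> carrier R"
      then obtain F where "F \<in> range psi" "b = fiber F" by (rule carrier_RE)
      then show "fiber (\<Delta> (value_of b)) = fiber (emb h * del (value_of b))" by (simp add: h)
    qed
    then show "D \<in> range multiple_der" by blast
  qed
  show "range multiple_der \<subseteq> LND R K"
    unfolding multiple_der_def using transport_LND lnd_scaled_del by blast
qed

lemma fiber_eq_0: "F \<in> range psi \<Longrightarrow> fiber F = \<zero>\<^bsub>R\<^esub> \<longleftrightarrow> F = 0"
  by (simp add: zero_R fiber_eq_iff range_psi_simps)

lemma funpow_del_mem: "F \<in> range psi \<Longrightarrow> (del ^^ i) F \<in> range psi"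
  by (induction i) (simp_all add: del_mem)

text \<open>
  Multiplication by an element of \<open>k[x]\<close> commutes with \<open>\<partial>\<close>, so the \<open>i\<close>-th power of \<open>h\<partial>\<close> is \<open>h\<^sup>i \<partial>\<^sup>i\<close>. In particular
  all non-zero multiples of \<open>\<partial>\<close> induce the same filtration.
\<close>

lemma ker_multiple_der:
  assumes "h \<noteq> 0"
  shows "ker R (multiple_der h ^^ i) = fiber ` {F \<in> range psi. (del ^^ i) F = 0}"
proof -
  have h: "emb h \<noteq> 0" using assms emb_eq_iff[of h 0] by (simp add: emb_simps)
  have "(multiple_der h ^^ i) (fiber F) = \<zero>\<^bsub>R\<^esub> \<longleftrightarrow> (del ^^ i) F = 0" if F: "F \<in> range psi" for F
  proof -
    have "emb h ^ i * (del ^^ i) F \<in> range psi"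
      using range_psi_simps(2)[OF range_psi_simps(4)[of "h ^ i"] funpow_del_mem[OF F]] by (simp add: emb_simps)
    moreover have "(multiple_der h ^^ i) (fiber F) = fiber (emb h ^ i * (del ^^ i) F)"
      using transport_funpow[of "\<lambda>F. emb h * del F" F i] F
      by (simp add: multiple_der_def funpow_scaled_del range_psi_simps del_mem)
    ultimately show ?thesis using h by (simp add: fiber_eq_0)
  qed
  then show ?thesis unfolding ker_def carrier_R by auto
qed

lemma ker_multiple_der_1: "h \<noteq> 0 \<Longrightarrow> ker R (multiple_der h) = R_kx n e P Q"
  using ker_multiple_der[of h 1] del_eq_0 del_simps(3) range_psi_simps(4)
  by (auto simp: kx_R)

lemma multiple_der_eq_zero_iff: "multiple_der h = zero_der R \<longleftrightarrow> h = 0"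
proof
  assume "multiple_der h = zero_der R"
  then have "multiple_der h (fiber sT) = \<zero>\<^bsub>R\<^esub>"
    by (simp add: zero_der_def fiber_carrier range_psi_simps)
  then have "fiber (emb h * del sT) = \<zero>\<^bsub>R\<^esub>"
    by (simp add: multiple_der_fiber range_psi_simps)
  then have "emb h * del sT = 0"
    by (subst (asm) fiber_eq_0) (intro range_psi_simps del_mem)
  then have "emb h = 0" by (simp add: del_vars xpow_nonzero)
  then show "h = 0" using emb_eq_iff[of h 0] by (simp add: emb_simps)
qed (simp add: multiple_der_def transport_def zero_der_def zero_R emb_simps)

lemma scale_multiple_der: "scale_der R (R_at_x n e P Q h) (multiple_der 1) = multiple_der h"
  unfolding scale_der_def
proof (rule extensionalityI[of _ "carrier R"])
  fix b assume b: "b \<in> carrier R"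
  then obtain F where F: "F \<in> range psi" "b = fiber F" by (rule carrier_RE)
  then show "(\<lambda>b\<in>carrier R. R_at_x n e P Q h \<otimes>\<^bsub>R\<^esub> multiple_der 1 b) b = multiple_der h b"
    using b by (simp add: at_x_R multiple_der_fiber R_operations range_psi_simps del_mem emb_simps)
qed (auto simp: multiple_der_def transport_def)

text \<open>
  Since \<open>\<partial>(y) \<noteq> 0\<close>, the prescribed value at \<open>y\<close> singles out \<open>\<partial>\<close> among its multiples.
\<close>

lemma is_R_der_iff: "is_R_der n e P Q \<delta> \<longleftrightarrow> \<delta> = multiple_der 1"
proof -
  have cl: "R_class n e P Q varX = fiber (xpow 1)" "R_class n e P Q varY = fiber yT"
    "R_class n e P Q varZ = fiber zT"
    "R_class n e P Q (varX ^ e * subst2 (pderiv P) (polS e Q)) = fiber (del yT)"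
    "R_class n e P Q (subst2 (pderiv Q) varY * subst2 (pderiv P) (polS e Q) - varX ^ n) = fiber (del zT)"
    by (simp_all add: R_class_fiber psi_simps psi_vars psi_subst2 psi_polS xpow_power del_vars)
  show ?thesis
  proof
    assume \<delta>: "is_R_der n e P Q \<delta>"
    then obtain h where h: "\<delta> = multiple_der h" unfolding is_R_der_def LND_R by blast
    have "fiber (emb h * del yT) = fiber (del yT)"
      using \<delta> by (simp add: is_R_der_def cl h multiple_der_fiber range_psi_simps)
    then have "emb h * del yT = del yT"
      by (subst (asm) fiber_eq_iff) (intro range_psi_simps del_mem)+
    moreover have "del yT \<noteq> 0"
    proof
      assume "del yT = 0"
      then obtain p where p: "yT = emb p" using del_eq_0[OF range_psi_simps(7)] by blast
      then have "p \<noteq> 0" using lead_nonzero[OF lead_yT] by (auto simp: emb_simps)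
      then obtain J v where "v \<noteq> 0" "lead yT 0 J v" unfolding p by (rule emb_lead)
      then show False using lead_unique(1)[OF lead_yT] d by fastforce
    qed
    ultimately have "emb h = emb 1" by (simp add: emb_simps)
    then show "\<delta> = multiple_der 1" using h by (simp add: emb_eq_iff)
  next
    assume \<delta>: "\<delta> = multiple_der 1"
    show "is_R_der n e P Q \<delta>"
      unfolding is_R_der_def cl LND_R \<delta>
      by (simp add: multiple_der_fiber range_psi_simps emb_simps zero_R del_vars(1))
  qed
qed

end

theorem corollary4p6:
  fixes n e d m :: nat
    and f g :: "nat \<Rightarrow> 'k::field_char_0 poly"
    and P Q :: "'k poly poly"
  assumes "n \<ge> 1" and "(n, e) \<noteq> (1, 0)" and "d \<ge> 2" and "m \<ge> 2"
    and "P = monom 1 d + (\<Sum>i<d. monom (f i) i)"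
    and "Q = monom 1 m + (\<Sum>j<m. monom (g j) j)"
  shows "(\<exists>!\<delta>. is_R_der n e P Q \<delta>) \<and>
    (\<forall>\<delta>. is_R_der n e P Q \<delta> \<longrightarrow>
      (makar_limanov (R_ring n e P Q) (R_base n e P Q) = R_kx n e P Q \<and>
       semi_rigid (R_ring n e P Q) (R_base n e P Q) \<and>
       is_unique_LND_filtration (R_ring n e P Q) (R_base n e P Q)
         (der_filtration (R_ring n e P Q) \<delta>)) \<and>
      ((\<forall>D\<in>LND (R_ring n e P Q) (R_base n e P Q).
          \<exists>h. D = scale_der (R_ring n e P Q) (R_at_x n e P Q h) \<delta>) \<and>
       almost_rigid (R_ring n e P Q) (R_base n e P Q)))"
proof -
  interpret double_danielewski n e d m f g P Q
    using assms by unfold_locales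
  have nonzero: "LND R K - {zero_der R} = multiple_der ` (UNIV - {0})"
    unfolding LND_R using multiple_der_eq_zero_iff by auto
  have filtration: "der_filtration R (multiple_der h) = der_filtration R (multiple_der 1)" if "h \<noteq> 0" for h
    unfolding der_filtration_def ker_multiple_der[OF that] ker_multiple_der[OF one_neq_zero] ..
  have "makar_limanov R K = R_kx n e P Q"
  proof
    show "makar_limanov R K \<subseteq> R_kx n e P Q"
      unfolding makar_limanov_def LND_R ker_multiple_der_1[OF one_neq_zero, symmetric] by blast
    have "R_kx n e P Q \<subseteq> ker R (multiple_der h)" for h
    proof (cases "h = 0")
      case True
      have "multiple_der h b = \<zero>\<^bsub>R\<^esub>" if "b \<in> carrier R" for b
        using that multiple_der_eq_zero_iff[of h] True by (simp add: zero_der_def)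
      moreover have "R_kx n e P Q \<subseteq> carrier R"
        unfolding kx_R carrier_R using range_psi_simps(4) by blast
      ultimately show ?thesis unfolding ker_def by blast
    qed (simp add: ker_multiple_der_1)
    then show "R_kx n e P Q \<subseteq> makar_limanov R K" unfolding makar_limanov_def LND_R by blast
  qed
  moreover have "semi_rigid R K"
    unfolding semi_rigid_def nonzero
  proof (intro ballI)
    fix D E assume "D \<in> multiple_der ` (UNIV - {0})" "E \<in> multiple_der ` (UNIV - {0})"
    then obtain h h' where h: "D = multiple_der h" "h \<noteq> 0" "E = multiple_der h'" "h' \<noteq> 0" by blast
    show "der_filtration R D = der_filtration R E"
      unfolding h(1,3) using filtration[OF h(2)] filtration[OF h(4)] by (rule trans[OF _ sym])
  qed
  moreover have "is_unique_LND_filtration R K (der_filtration R (multiple_der 1))"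
    unfolding is_unique_LND_filtration_def nonzero
  proof (intro subset_antisym subsetI)
    fix x assume "x \<in> der_filtration R ` multiple_der ` (UNIV - {0})"
    then obtain h where h: "x = der_filtration R (multiple_der h)" "h \<noteq> 0" by blast
    show "x \<in> {der_filtration R (multiple_der 1)}"
      by (simp only: h(1) singleton_iff filtration[OF h(2)])
  next
    fix x assume "x \<in> {der_filtration R (multiple_der 1)}"
    then show "x \<in> der_filtration R ` multiple_der ` (UNIV - {0})" by simp
  qed
  moreover have "\<forall>D\<in>LND R K. \<exists>h. D = scale_der R (R_at_x n e P Q h) (multiple_der 1)"
    unfolding scale_multiple_der LND_R by blast
  moreover have "almost_rigid R K"
    unfolding almost_rigid_def
  proof (intro bexI)
    show "multiple_der 1 \<in> LND R K - {zero_der R}" unfolding nonzero by simp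
    show "LND R K = (\<lambda>a. scale_der R a (multiple_der 1)) ` ker R (multiple_der 1)"
      unfolding ker_multiple_der_1[OF one_neq_zero] R_kx_def image_image scale_multiple_der LND_R ..
  qed
  ultimately show ?thesis unfolding is_R_der_iff by simp
qed

end
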